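(* Let $T$ be a proper tree. Suppose that, among the leaf components of $T$, the order of every component whose center is a nonleaf vertex of the internal core $\mathcal C(T)$ occurs exactly once; that is, for every vertex $v$ of $\mathcal C(T)$ with $\deg_{\mathcal C(T)}(v)\ge 2$, no vertex $u\neq v$ of $\mathcal C(T)$ satisfies $\omega_T(u)=\omega_T(v)$. Then $T$ is determined up to isomorphism by its chromatic symmetric function: every tree $T'$ with $\mathbf X_{T'}=\mathbf X_T$ is isomorphic to $T$.
   Context: All trees are finite. For a finite simple graph $G$, the chromatic symmetric function is $\mathbf X_G=\sum_{\kappa}\prod_{v\in V(G)}x_{\kappa(v)}$, a formal power series in commuting variables $x_1,x_2,\dots$, where $\kappa$ ranges over all proper colorings $\kappa:V(G)\to\{1,2,3,\dots\}$ (adjacent vertices receive different colors). A leaf is a vertex of degree one. For a tree $T$, the internal core $\mathcal C(T)$ is the subtree induced by the nonleaf vertices of $T$. The tree $T$ is proper if every vertex of $\mathcal C(T)$ is adjacent in $T$ to at least one leaf of $T$. For a proper tree $T$ and $v\in V(\mathcal C(T))$ put $$\omega_T(v)=1+\#\{u\in V(T): u\text{ is a leaf of }T\text{ and }uv\in E(T)\}.$$ An edge of $T$ is a leaf edge if one of its endpoints is a leaf, and an internal edge otherwise. The leaf components of $T$ are the connected components of the graph obtained from $T$ by deleting all internal edges. For a proper tree with nonempty internal core these are stars, one centered at each $v\in V(\mathcal C(T))$, and the one centered at $v$ has order (number of vertices) $\omega_T(v)$. *)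

theory Defs
  imports Main "HOL-Library.FuncSet" "HOL-Library.Poly_Mapping"
begin

record 'a graph =
  verts :: "'a set"
  edges :: "'a set set"

definition finite_simple_graph :: "'a graph \<Rightarrow> bool" where
  "finite_simple_graph G \<longleftrightarrow>
     finite (verts G) \<and> (\<forall>e\<in>edges G. e \<subseteq> verts G \<and> card e = 2)"

definition adjacent :: "'a graph \<Rightarrow> 'a \<Rightarrow> 'a \<Rightarrow> bool" where
  "adjacent G u v \<longleftrightarrow> {u, v} \<in> edges G"

definition degree :: "'a graph \<Rightarrow> 'a \<Rightarrow> nat" where
  "degree G v = card {u \<in> verts G. adjacent G u v}"

definition induced_subgraph :: "'a graph \<Rightarrow> 'a set \<Rightarrow> 'a graph" where
  "induced_subgraph G W = \<lparr>verts = verts G \<inter> W, edges = {e \<in> edges G. e \<subseteq> W}\<rparr>"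

definition connected_graph :: "'a graph \<Rightarrow> bool" where
  "connected_graph G \<longleftrightarrow>
     verts G \<noteq> {} \<and> (\<forall>u\<in>verts G. \<forall>v\<in>verts G. (adjacent G)\<^sup>*\<^sup>* u v)"

text \<open>A cycle is given by the list of its distinct vertices in cyclic order.\<close>

definition is_cycle :: "'a graph \<Rightarrow> 'a list \<Rightarrow> bool" where
  "is_cycle G vs \<longleftrightarrow> length vs \<ge> 3 \<and> distinct vs \<and> set vs \<subseteq> verts G \<and>
     (\<forall>i<length vs. adjacent G (vs ! i) (vs ! (Suc i mod length vs)))"

definition tree :: "'a graph \<Rightarrow> bool" where
  "tree G \<longleftrightarrow> finite_simple_graph G \<and> connected_graph G \<and> (\<nexists>vs. is_cycle G vs)"

definition graph_isomorphic :: "'a graph \<Rightarrow> 'b graph \<Rightarrow> bool" where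
  "graph_isomorphic G H \<longleftrightarrow>
     (\<exists>f. bij_betw f (verts G) (verts H) \<and>
          (\<forall>u\<in>verts G. \<forall>v\<in>verts G. adjacent G u v \<longleftrightarrow> adjacent H (f u) (f v)))"

definition is_leaf :: "'a graph \<Rightarrow> 'a \<Rightarrow> bool" where
  "is_leaf G v \<longleftrightarrow> v \<in> verts G \<and> degree G v = 1"

definition internal_core :: "'a graph \<Rightarrow> 'a graph" where
  "internal_core T = induced_subgraph T {v \<in> verts T. \<not> is_leaf T v}"

definition proper_tree :: "'a graph \<Rightarrow> bool" where
  "proper_tree T \<longleftrightarrow>
     tree T \<and> (\<forall>v\<in>verts (internal_core T). \<exists>u. is_leaf T u \<and> adjacent T u v)"

text \<open>The weight \<open>\<omega>\<^sub>T(v)\<close>: the order of the leaf component centred at \<open>v\<close>.\<close>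

definition leaf_weight :: "'a graph \<Rightarrow> 'a \<Rightarrow> nat" where
  "leaf_weight T v = 1 + card {u \<in> verts T. is_leaf T u \<and> adjacent T u v}"

text \<open>
  Colourings are extensional functions (with value \<open>undefined\<close> off the vertex set), so that
  distinct elements of this set are distinct colourings of the vertices.
\<close>

definition proper_colourings :: "'a graph \<Rightarrow> ('a \<Rightarrow> nat) set" where
  "proper_colourings G =
     {\<kappa> \<in> verts G \<rightarrow>\<^sub>E {1..}. \<forall>u\<in>verts G. \<forall>v\<in>verts G. adjacent G u v \<longrightarrow> \<kappa> u \<noteq> \<kappa> v}"

text \<open>
  A monomial in \<open>x\<^sub>1, x\<^sub>2, \<dots>\<close> is represented by its finitely supported exponent vector, and
  a formal power series by its family of coefficients; a product of monomials is therefore a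
  sum of exponent vectors.
\<close>

type_synonym monomial = "nat \<Rightarrow>\<^sub>0 nat"
type_synonym power_series = "monomial \<Rightarrow> int"

definition colouring_monomial :: "'a graph \<Rightarrow> ('a \<Rightarrow> nat) \<Rightarrow> monomial" where
  "colouring_monomial G \<kappa> = (\<Sum>v\<in>verts G. Poly_Mapping.single (\<kappa> v) 1)"

text \<open>
  The coefficient of \<open>m\<close> in \<open>\<Sum>\<^sub>\<kappa> \<Prod>\<^sub>v x\<^bsub>\<kappa>(v)\<^esub>\<close>. The lemma below shows that the set being
  counted is finite.
\<close>

definition chromatic_symmetric_function :: "'a graph \<Rightarrow> power_series" where
  "chromatic_symmetric_function G =
     (\<lambda>m. int (card {\<kappa> \<in> proper_colourings G. colouring_monomial G \<kappa> = m}))"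

lemma finite_colourings_with_monomial:
  assumes "finite_simple_graph G"
  shows "finite {\<kappa> \<in> proper_colourings G. colouring_monomial G \<kappa> = m}"
proof -
  have fin: "finite (verts G)"
    using assms by (simp add: finite_simple_graph_def)
  have "\<kappa> v \<in> Poly_Mapping.keys (colouring_monomial G \<kappa>)" if "v \<in> verts G" for \<kappa> v
  proof -
    have "Poly_Mapping.lookup (colouring_monomial G \<kappa>) (\<kappa> v) =
        (\<Sum>w\<in>verts G. Poly_Mapping.lookup (Poly_Mapping.single (\<kappa> w) (1::nat)) (\<kappa> v))"
      by (simp add: colouring_monomial_def lookup_sum)
    also have "\<dots> \<ge> Poly_Mapping.lookup (Poly_Mapping.single (\<kappa> v) (1::nat)) (\<kappa> v)"
      using fin that by (intro member_le_sum) auto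
    finally show ?thesis
      by (simp add: in_keys_iff)
  qed
  then have "{\<kappa> \<in> proper_colourings G. colouring_monomial G \<kappa> = m}
      \<subseteq> verts G \<rightarrow>\<^sub>E Poly_Mapping.keys m"
    by (auto simp: proper_colourings_def PiE_iff extensional_def)
  moreover have "finite (verts G \<rightarrow>\<^sub>E Poly_Mapping.keys m)"
    using fin by (intro finite_PiE) auto
  ultimately show ?thesis
    by (rule finite_subset)
qed

end

theory Submission
  imports Defs "HOL-Library.Multiset" "HOL-Library.Transitive_Closure_Table"
begin

text \<open>
  Inclusion--exclusion over the monochromatic edges expands the chromatic symmetric function of a
  tree \<open>T\<close> as the sum over edge subsets \<open>A\<close> of \<open>(-1)\<^bsup>|A|\<^esup>\<close> times the product of the power sums
  indexed by the component orders of \<open>A\<close>. These products are linearly independent, and in a tree the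
  number of components determines \<open>|A|\<close>, so \<open>X\<^sub>T\<close> determines how many edge subsets have any given
  type, that is, multiset of component orders.

  An edge subset has no part 1 in its type iff it covers all vertices. Hence \<open>X\<^sub>T\<close> determines the number
  of leaf edges, and if \<open>T\<close> is proper then the leaf edges form the unique smallest cover, in \<open>T\<close> as
  well as in \<open>T'\<close>. Their type is the multiset of weights of the core; adding one core edge \<open>uv\<close>
  merges the parts \<open>\<omega>(u)\<close> and \<open>\<omega>(v)\<close>, which reveals the pair of weights of every core edge. A weight
  occurring more than once belongs only to leaves of the core, whose neighbours have unique weights
  (unless the core has at most two vertices), so
  these pairs determine the weighted core, and with it \<open>T\<close>.
\<close>

section \<open>Bijections from equal multisets of values\<close>

text \<open>Equal multisets of values mean that every value is taken equally often on both sides, so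
  the elements can be paired off one at a time. This turns equal counts into bijections that respect
  the values.\<close>

lemma bij_betw_of_image_mset_eq:
  assumes "finite P" "finite Q" "image_mset f (mset_set P) = image_mset g (mset_set Q)"
  shows "\<exists>h. bij_betw h P Q \<and> (\<forall>x\<in>P. g (h x) = f x)"
  using assms
proof (induction P arbitrary: Q rule: finite_induct)
  case empty
  then have "Q = {}" by (auto simp: mset_set_empty_iff)
  then show ?case by (auto simp: bij_betw_def)
next
  case (insert a P)
  have "f a \<in># image_mset g (mset_set Q)"
    using insert by (metis image_mset_add_mset mset_set.insert union_single_eq_member)
  then obtain b where b: "b \<in> Q" "g b = f a"
    using insert.prems by auto
  have "mset_set Q = add_mset b (mset_set (Q - {b}))"
    using b insert.prems by (simp add: mset_set.remove)
  then have "image_mset f (mset_set P) = image_mset g (mset_set (Q - {b}))"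
    using insert b by simp
  then obtain h where h: "bij_betw h P (Q - {b})" "\<forall>x\<in>P. g (h x) = f x"
    using insert.IH[of "Q - {b}"] insert.prems by auto
  have "bij_betw (h(a := b)) P (Q - {b})"
    using h(1) insert.hyps by (subst bij_betw_cong[of P _ h]) auto
  then have "bij_betw (h(a := b)) (P \<union> {a}) ((Q - {b}) \<union> {(h(a := b)) a})"
    using insert.hyps by (intro notIn_Un_bij_betw) auto
  then have "bij_betw (h(a := b)) (insert a P) (insert b (Q - {b}))"
    by simp
  moreover have "insert b (Q - {b}) = Q"
    using b by auto
  ultimately show ?case
    using h b insert.hyps by (metis fun_upd_apply insertE)
qed

lemma image_mset_mset_set_bij_betw:
  assumes "bij_betw h P Q" "\<And>x. x \<in> P \<Longrightarrow> g (h x) = f x"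
  shows "image_mset f (mset_set P) = image_mset g (mset_set Q)"
proof -
  have "mset_set Q = image_mset h (mset_set P)"
    using assms(1) by (simp add: bij_betw_def image_mset_mset_set)
  then have "image_mset g (mset_set Q) = image_mset (g \<circ> h) (mset_set P)"
    by (simp add: multiset.map_comp)
  also have "\<dots> = image_mset f (mset_set P)"
    using assms(2) by (cases "finite P") (auto intro!: image_mset_cong)
  finally show ?thesis by simp
qed

lemma count_image_mset_mset_set:
  assumes "finite P"
  shows "count (image_mset f (mset_set P)) y = card {x \<in> P. f x = y}"
proof -
  have "count (image_mset f (mset_set P)) y = (\<Sum>x | x \<in> P \<and> y = f x. count (mset_set P) x)"
    using assms by (simp add: count_image_mset')
  also have "\<dots> = (\<Sum>x | x \<in> P \<and> f x = y. 1)"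
    using assms by (intro sum.cong) auto
  finally show ?thesis by simp
qed

lemma image_mset_mset_set_eqI:
  assumes "finite P" "finite Q" "\<And>y. card {x \<in> P. f x = y} = card {x \<in> Q. g x = y}"
  shows "image_mset f (mset_set P) = image_mset g (mset_set Q)"
  using assms by (intro multiset_eqI) (simp add: count_image_mset_mset_set)

section \<open>Components of a set of edges\<close>

text \<open>The vertex set does not enter: off \<open>\<Union>A\<close> a vertex is joined only to
  itself. This is why \<open>components\<close> takes \<open>V\<close> separately and so also counts
  the isolated vertices.\<close>

definition joined :: "'a set set \<Rightarrow> 'a \<Rightarrow> 'a \<Rightarrow> bool" where
  "joined A = (\<lambda>x y. {x, y} \<in> A)\<^sup>*\<^sup>*"

definition component :: "'a set set \<Rightarrow> 'a \<Rightarrow> 'a set" where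
  "component A v = {u. joined A v u}"

definition components :: "'a set \<Rightarrow> 'a set set \<Rightarrow> 'a set set" where
  "components V A = component A ` V"

definition component_type :: "'a set \<Rightarrow> 'a set set \<Rightarrow> nat multiset" where
  "component_type V A = image_mset card (mset_set (components V A))"

lemma joined_refl [simp]: "joined A x x"
  by (simp add: joined_def)

lemma joined_sym: "joined A x y \<Longrightarrow> joined A y x"
proof -
  have "symp ((\<lambda>x y. {x, y} \<in> A)\<^sup>*\<^sup>*)"
    by (intro symp_rtranclp sympI) (simp add: insert_commute)
  then show "joined A x y \<Longrightarrow> joined A y x"
    by (simp add: joined_def symp_def)
qed

lemma joined_trans: "joined A x y \<Longrightarrow> joined A y z \<Longrightarrow> joined A x z"
  by (simp add: joined_def)

lemma joined_edge: "{x, y} \<in> A \<Longrightarrow> joined A x y"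
  by (auto simp: joined_def)

lemma joined_induct [consumes 1, case_names refl step]:
  assumes "joined A x y" "P x" "\<And>y z. joined A x y \<Longrightarrow> P y \<Longrightarrow> {y, z} \<in> A \<Longrightarrow> P z"
  shows "P y"
  using assms(1)[unfolded joined_def]
proof (induction rule: rtranclp_induct)
  case base
  show ?case by (rule assms(2))
next
  case (step y z)
  then show ?case
    using assms(3)[of y z] by (simp add: joined_def)
qed

lemma joined_mono:
  assumes "joined A x y" "A \<subseteq> B"
  shows "joined B x y"
  using assms(1)
proof (induction rule: joined_induct)
  case (step y z)
  then have "joined B y z"
    using assms(2) by (intro joined_edge) auto
  with step.IH show ?case by (rule joined_trans)
qed simp

lemma component_eq_iff: "component A u = component A v \<longleftrightarrow> joined A u v"
proof
  assume "component A u = component A v"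
  then have "v \<in> component A u"
    by (simp add: component_def)
  then show "joined A u v"
    by (simp add: component_def)
next
  assume "joined A u v"
  then show "component A u = component A v"
    unfolding component_def by (intro Collect_cong iffI) (metis joined_sym joined_trans)+
qed

lemma component_self [simp]: "v \<in> component A v"
  by (simp add: component_def)

lemma component_eqI: "x \<in> component A v \<Longrightarrow> component A x = component A v"
  by (metis component_def component_eq_iff joined_sym mem_Collect_eq)

lemma component_subset:
  assumes "\<Union>A \<subseteq> V" "v \<in> V"
  shows "component A v \<subseteq> V"
proof
  fix x assume "x \<in> component A v"
  then have "joined A v x" by (simp add: component_def)
  then show "x \<in> V" using assms by (induction rule: joined_induct) auto
qed

text \<open>With this, a sum over \<open>V\<close> grouped by the value of
  \<open>component A\<close> becomes a sum over the components themselves.\<close>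

lemma components_fiber:
  assumes "\<Union>A \<subseteq> V" "B \<in> components V A"
  shows "{v \<in> V. component A v = B} = B"
proof -
  obtain b where b: "b \<in> V" "B = component A b"
    using assms by (auto simp: components_def)
  show ?thesis
  proof (intro set_eqI iffI)
    fix v assume "v \<in> B"
    then show "v \<in> {v \<in> V. component A v = B}"
      using component_subset[OF assms(1) b(1)] component_eqI[of v A b] b(2) by auto
  next
    fix v assume "v \<in> {v \<in> V. component A v = B}"
    then show "v \<in> B"
      by (metis (mono_tags) component_self mem_Collect_eq)
  qed
qed

lemma finite_components: "finite V \<Longrightarrow> finite (components V A)"
  by (simp add: components_def)

text \<open>The components partition \<open>V\<close>. Consequently the type of any single edge
  subset already reveals the number of vertices.\<close>

lemma sum_mset_component_type:
  assumes "finite V" "\<Union>A \<subseteq> V"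
  shows "sum_mset (component_type V A) = card V"
proof -
  have "sum_mset (component_type V A) = (\<Sum>B\<in>components V A. card B)"
    by (simp add: component_type_def sum_unfold_sum_mset)
  also have "\<dots> = (\<Sum>B\<in>components V A. \<Sum>v | v \<in> V \<and> component A v = B. 1)"
    using components_fiber[OF assms(2)] by (intro sum.cong) auto
  also have "\<dots> = (\<Sum>v\<in>V. 1)"
    using sum.group[OF assms(1) finite_components[OF assms(1)], of "component A" A "\<lambda>_. 1::nat"]
    by (simp add: components_def)
  finally show ?thesis by simp
qed

lemma component_finite:
  assumes "finite V" "\<Union>A \<subseteq> V" "B \<in> components V A"
  shows "finite B" "B \<noteq> {}"
proof -
  obtain b where b: "b \<in> V" "B = component A b"
    using assms(3) by (auto simp: components_def)
  show "finite B"
    using component_subset[OF assms(2) b(1)] assms(1) b(2) by (auto intro: finite_subset)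
  show "B \<noteq> {}"
    using b(2) by (metis component_self empty_iff)
qed

lemma component_type_pos:
  assumes "finite V" "\<Union>A \<subseteq> V" "k \<in># component_type V A"
  shows "k > 0"
proof -
  obtain B where "B \<in> components V A" "k = card B"
    using assms(1,3) by (auto simp: component_type_def finite_components)
  then show ?thesis
    using component_finite[OF assms(1,2)] by (simp add: card_gt_0_iff)
qed

text \<open>A component of order one is a vertex on no edge of \<open>A\<close>, so covering can be
  read off the type. Edges must have two ends here: a loop would cover its vertex and still leave it
  alone.\<close>

lemma one_in_component_type_iff:
  assumes "finite V" "\<Union>A \<subseteq> V" "\<forall>e\<in>A. card e = 2"
  shows "1 \<in># component_type V A \<longleftrightarrow> \<not> V \<subseteq> \<Union>A"
proof -
  have iso: "card (component A v) = 1 \<longleftrightarrow> v \<notin> \<Union>A" if v: "v \<in> V" for v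
  proof
    assume c: "card (component A v) = 1"
    then have cv: "component A v = {v}"
      using component_self[of v A] by (metis card_1_singletonE singletonD)
    show "v \<notin> \<Union>A"
    proof
      assume "v \<in> \<Union>A"
      then obtain e where e: "e \<in> A" "v \<in> e" by auto
      obtain a b where "e = {a, b}" "a \<noteq> b"
        using e(1) assms(3) by (metis card_2_iff)
      then obtain w where "e = {v, w}" "v \<noteq> w"
        using e(2) by (auto simp: insert_commute)
      then show False
        using e cv joined_edge[of v w A] by (auto simp: component_def)
    qed
  next
    assume n: "v \<notin> \<Union>A"
    have "x = v" if "joined A v x" for x
      using that n by (induction rule: joined_induct) auto
    then have "component A v = {v}" by (auto simp: component_def)
    then show "card (component A v) = 1" by simp
  qed
  have "1 \<in># component_type V A \<longleftrightarrow> (\<exists>v\<in>V. card (component A v) = 1)"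
  proof -
    have "set_mset (component_type V A) = card ` component A ` V"
      using finite_components[OF assms(1), of A] by (simp add: component_type_def components_def)
    then show ?thesis by (metis (no_types, lifting) imageE image_eqI)
  qed
  then show ?thesis using iso by auto
qed

text \<open>A walk through the new edge can be shortened until it uses that edge once, in one of the
  two directions.\<close>

lemma joined_insert:
  "joined (insert {u, v} A) x y \<longleftrightarrow>
     joined A x y \<or> joined A x u \<and> joined A v y \<or> joined A x v \<and> joined A u y"
  (is "?L \<longleftrightarrow> ?R")
proof
  assume ?L
  then show ?R
  proof (induction rule: joined_induct)
    case (step y z)
    show ?case
    proof (cases "{y, z} \<in> A")
      case True
      then have "joined A y z" by (rule joined_edge)
      then show ?thesis using step.IH joined_trans[of A _ y z] by blast
    next
      case False
      then have "y = u \<and> z = v \<or> y = v \<and> z = u"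
        using step.hyps by (auto simp: doubleton_eq_iff)
      then show ?thesis using step.IH by auto
    qed
  qed simp
next
  assume ?R
  moreover have "joined (insert {u, v} A) u v" "joined (insert {u, v} A) v u"
    by (auto intro!: joined_edge simp: insert_commute)
  ultimately show ?L
    by (metis joined_mono joined_trans subset_insertI)
qed

lemma component_insert:
  "component (insert {u, v} A) x =
     (if x \<in> component A u \<union> component A v then component A u \<union> component A v else component A x)"
proof (rule set_eqI)
  have mem: "y \<in> component B x \<longleftrightarrow> joined B x y" for B x and y :: 'a
    by (simp add: component_def)
  fix y
  \<comment> \<open>Being joined is equality of components. With a, b the components of u, v and c,
    c' those of x, y, the claim becomes a statement about equality alone.\<close>
  have "c = c' \<or> c = a \<and> b = c' \<or> c = b \<and> a = c' \<longleftrightarrow>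
      (if a = c \<or> b = c then a = c' \<or> b = c' else c = c')" for a b c c' :: "'a set"
    by metis
  from this[of "component A x" "component A y" "component A u" "component A v"]
  show "y \<in> component (insert {u, v} A) x \<longleftrightarrow> y \<in> (if x \<in> component A u \<union> component A v
      then component A u \<union> component A v else component A x)"
    unfolding if_distrib[of "\<lambda>S. y \<in> S"] Un_iff mem joined_insert component_eq_iff .
qed

text \<open>The new edge replaces two distinct components by their disjoint union. Both sides are
  sums so that no difference of multisets occurs.\<close>

lemma component_type_insert:
  assumes "finite V" "\<Union>A \<subseteq> V" "u \<in> V" "v \<in> V" "\<not> joined A u v"
  shows "component_type V (insert {u, v} A) + {#card (component A u), card (component A v)#} =
           component_type V A + {#card (component A u) + card (component A v)#}"
proof -
  let ?U = "component A u" and ?W = "component A v"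
  have ne: "?U \<noteq> ?W"
    using assms(5) by (simp add: component_eq_iff)
  have disj: "?U \<inter> ?W = {}"
    using ne by (metis component_eqI disjoint_iff)
  have fin: "finite ?U" "finite ?W"
    using assms component_subset by (metis finite_subset)+
  have UW: "?U \<in> components V A" "?W \<in> components V A"
    using assms by (auto simp: components_def)
  let ?C = "components V A - {?U, ?W}"
  have finC: "finite ?C"
    using assms(1) by (simp add: finite_components)
  \<comment> \<open>\<open>mset_set\<close> gains an element from an insertion only if the inserted
    set is new, hence this check that the union is none of the remaining components.\<close>
  have new: "?U \<union> ?W \<notin> ?C"
  proof
    assume "?U \<union> ?W \<in> ?C"
    then obtain x where "component A x = ?U \<union> ?W" "component A x \<noteq> ?U"
      by (auto simp: components_def)
    then show False by (metis UnI1 component_eqI component_self)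
  qed
  have "components V (insert {u, v} A) = insert (?U \<union> ?W) ?C"
  proof (intro set_eqI iffI)
    fix B assume "B \<in> components V (insert {u, v} A)"
    then obtain x where x: "x \<in> V" "B = component (insert {u, v} A) x"
      by (auto simp: components_def)
    show "B \<in> insert (?U \<union> ?W) ?C"
    proof (cases "x \<in> ?U \<union> ?W")
      case True
      then show ?thesis using x(2) by (simp add: component_insert)
    next
      case False
      then have "B = component A x" "x \<notin> ?U" "x \<notin> ?W"
        using x(2) by (simp_all add: component_insert)
      then show ?thesis using x(1) component_self[of x A] by (auto simp only: components_def)
    qed
  next
    fix B assume "B \<in> insert (?U \<union> ?W) ?C"
    then consider "B = ?U \<union> ?W" | "B \<in> ?C" by auto
    then show "B \<in> components V (insert {u, v} A)"
    proof cases
      case 1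
      then have "B = component (insert {u, v} A) u" by (simp add: component_insert)
      then show ?thesis using assms(3) by (simp add: components_def)
    next
      case 2
      then obtain x where x: "x \<in> V" "B = component A x" "B \<noteq> ?U" "B \<noteq> ?W"
        by (auto simp: components_def)
      then have "x \<notin> ?U \<union> ?W"
        by (metis UnE component_eqI)
      then have "B = component (insert {u, v} A) x"
        using x by (simp add: component_insert)
      then show ?thesis using x by (simp add: components_def)
    qed
  qed
  moreover have "mset_set (components V A) = mset_set ?C + {#?U, ?W#}"
  proof -
    have "components V A = insert ?U (insert ?W ?C)" using UW by auto
    then have "mset_set (components V A) = mset_set (insert ?U (insert ?W ?C))" by simp
    then show ?thesis using finC ne by (simp add: mset_set.insert)
  qed
  moreover have "mset_set (insert (?U \<union> ?W) ?C) = add_mset (?U \<union> ?W) (mset_set ?C)"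
    using new finC by simp
  ultimately show ?thesis
    using disj fin by (simp add: component_type_def card_Un_disjoint)
qed

section \<open>Edge subsets of a tree\<close>

lemma edges_subset_verts: "finite_simple_graph G \<Longrightarrow> A \<subseteq> edges G \<Longrightarrow> \<Union>A \<subseteq> verts G"
  by (auto simp: finite_simple_graph_def)

lemma finite_edges: "finite_simple_graph G \<Longrightarrow> finite (edges G)"
  by (rule finite_subset[of _ "Pow (verts G)"]) (auto simp: finite_simple_graph_def)

text \<open>A simple path inside \<open>A\<close> from u to v would be closed to a cycle by the edge
  uv.\<close>

lemma tree_edge_not_joined:
  assumes "tree G" "A \<subseteq> edges G" "{u, v} \<in> edges G" "{u, v} \<notin> A"
  shows "\<not> joined A u v"
proof
  assume "joined A u v"
  then obtain xs where "rtrancl_path (\<lambda>x y. {x, y} \<in> A) u xs v"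
    unfolding joined_def rtranclp_eq_rtrancl_path by auto
  then obtain ys where path: "rtrancl_path (\<lambda>x y. {x, y} \<in> A) u ys v" and dist: "distinct (u # ys)"
    by (rule rtrancl_path_distinct)
  have sg: "finite_simple_graph G" using assms(1) by (simp add: tree_def)
  have "u \<noteq> v"
    using sg assms(3) by (auto simp: finite_simple_graph_def)
  then have ne: "ys \<noteq> []" using path by (auto elim: rtrancl_path.cases)
  then have last: "last ys = v" using path rtrancl_path_last by metis
  have nth: "{(u # ys) ! i, ys ! i} \<in> A" if "i < length ys" for i
    using rtrancl_path_nth[OF path that] .
  \<comment> \<open>A path with a single edge would consist of the edge uv, which is not in
    \<open>A\<close>. So the path has at least three vertices.\<close>
  have "length ys \<noteq> 1"
  proof
    assume "length ys = 1"
    then have "ys = [v]" using last by (auto simp: length_Suc_conv)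
    then show False using nth[of 0] assms(4) by simp
  qed
  then have len: "length (u # ys) \<ge> 3" using ne by (cases ys rule: list.exhaust) (auto simp: Suc_le_eq)
  \<comment> \<open>For all indices but the last this is an edge of the path; at the last one the
    index wraps around from v to u, and uv closes the cycle.\<close>
  have adj: "adjacent G ((u # ys) ! i) ((u # ys) ! (Suc i mod length (u # ys)))"
    if "i < length (u # ys)" for i
  proof (cases "i = length ys")
    case True
    then have "(u # ys) ! i = v" using last ne by (simp add: last_conv_nth)
    then show ?thesis using True assms(3) by (simp add: adjacent_def insert_commute)
  next
    case False
    then have "i < length ys" using that by simp
    then show ?thesis using nth[of i] assms(2) by (auto simp: adjacent_def)
  qed
  have "set (u # ys) \<subseteq> verts G"
  proof
    fix x assume "x \<in> set (u # ys)"
    then obtain i where "i < length (u # ys)" "(u # ys) ! i = x"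
      by (metis in_set_conv_nth)
    then show "x \<in> verts G" using adj[of i] sg by (auto simp: adjacent_def finite_simple_graph_def)
  qed
  then have "is_cycle G (u # ys)"
    using len dist adj by (simp add: is_cycle_def)
  then show False using assms(1) by (auto simp: tree_def)
qed

lemma component_type_insert_edge:
  assumes "tree G" "A \<subseteq> edges G" "{u, v} \<in> edges G" "{u, v} \<notin> A"
  shows "component_type (verts G) (insert {u, v} A) +
             {#card (component A u), card (component A v)#} =
           component_type (verts G) A + {#card (component A u) + card (component A v)#}"
proof -
  have sg: "finite_simple_graph G" using assms(1) by (simp add: tree_def)
  then have "u \<in> verts G" "v \<in> verts G" "finite (verts G)"
    using assms(3) by (auto simp: finite_simple_graph_def)
  then show ?thesis
    using assms sg by (intro component_type_insert tree_edge_not_joined edges_subset_verts)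
qed

text \<open>In a forest each added edge joins two different components, so the number of components
  drops by exactly one, starting from all vertices as singletons. This is what ties the sign of an
  edge subset to its type.\<close>

lemma card_plus_size_component_type:
  assumes "tree G" "A \<subseteq> edges G"
  shows "card A + size (component_type (verts G) A) = card (verts G)"
proof -
  have sg: "finite_simple_graph G" using assms(1) by (simp add: tree_def)
  have "finite A" using assms(2) finite_edges[OF sg] by (rule finite_subset)
  then show ?thesis using assms(2)
  proof (induction A rule: finite_induct)
    case empty
    have "component {} v = {v}" for v :: 'a
    proof -
      have "x = v" if "joined {} v x" for x
        using that by (induction rule: joined_induct) auto
      then show ?thesis by (auto simp: component_def)
    qed
    then show ?case by (simp add: component_type_def components_def card_image)
  next
    case (insert e A)
    obtain u v where e: "e = {u, v}"
      using insert.prems sg by (auto simp: finite_simple_graph_def card_2_iff)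
    have "size (component_type (verts G) (insert e A)) + 2 = size (component_type (verts G) A) + 1"
    proof -
      have "A \<subseteq> edges G" "{u, v} \<in> edges G" "{u, v} \<notin> A"
        using insert.prems insert.hyps(2) e by auto
      from arg_cong[OF component_type_insert_edge[OF assms(1) this], of size] show ?thesis
        by (simp add: e)
    qed
    moreover have "card A + size (component_type (verts G) A) = card (verts G)"
      using insert.IH insert.prems by simp
    ultimately show ?case using insert.hyps by simp
  qed
qed

section \<open>Power sums\<close>

text \<open>The coefficient at \<open>m\<close> of \<open>\<Prod>x\<in>P. p\<^bsub>w x\<^esub>\<close>, where \<open>p\<^sub>k\<close> is the \<open>k\<close>th power sum, is the
  number of these colourings.\<close>

definition weighted_colourings :: "'a set \<Rightarrow> ('a \<Rightarrow> nat) \<Rightarrow> monomial \<Rightarrow> ('a \<Rightarrow> nat) set" where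
  "weighted_colourings P w m =
     {g \<in> P \<rightarrow>\<^sub>E {1..}. (\<Sum>x\<in>P. Poly_Mapping.single (g x) (w x)) = m}"

text \<open>A multiset cannot index a product, so the positions of its sorted list do. By
  \<open>card_weighted_colourings\<close> any other finite family with the same weights gives the
  same number.\<close>

definition power_sum_coeff :: "nat multiset \<Rightarrow> monomial \<Rightarrow> nat" where
  "power_sum_coeff M m = card (weighted_colourings {..<size M} ((!) (sorted_list_of_multiset M)) m)"

lemma card_weighted_colourings_bij_betw:
  assumes h: "bij_betw h P Q" and w: "\<And>x. x \<in> P \<Longrightarrow> v (h x) = w x"
  shows "card (weighted_colourings P w m) = card (weighted_colourings Q v m)"
proof -
  let ?F = "\<lambda>g. \<lambda>x\<in>P. g (h x)" and ?G = "\<lambda>g. \<lambda>y\<in>Q. g (inv_into P h y)"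
  have hP: "h x \<in> Q" "inv_into P h (h x) = x" if "x \<in> P" for x
    using h that by (auto simp: bij_betw_def)
  have iQ: "inv_into P h y \<in> P" "h (inv_into P h y) = y" if "y \<in> Q" for y
    using h that by (auto simp: bij_betw_def inv_into_into f_inv_into_f)
  have "bij_betw ?F (weighted_colourings Q v m) (weighted_colourings P w m)"
  proof (rule bij_betw_byWitness[where f' = ?G])
    show "\<forall>g\<in>weighted_colourings Q v m. ?G (?F g) = g"
      using iQ by (auto simp: weighted_colourings_def fun_eq_iff PiE_iff extensional_def)
    show "\<forall>g\<in>weighted_colourings P w m. ?F (?G g) = g"
      using hP by (auto simp: weighted_colourings_def fun_eq_iff PiE_iff extensional_def)
    show "?F ` weighted_colourings Q v m \<subseteq> weighted_colourings P w m"
    proof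
      fix k assume "k \<in> ?F ` weighted_colourings Q v m"
      then obtain g where g: "g \<in> Q \<rightarrow>\<^sub>E {1..}" "(\<Sum>y\<in>Q. Poly_Mapping.single (g y) (v y)) = m"
        and k: "k = ?F g"
        by (auto simp: weighted_colourings_def)
      have "(\<Sum>x\<in>P. Poly_Mapping.single (k x) (w x)) = (\<Sum>y\<in>Q. Poly_Mapping.single (g y) (v y))"
        using k w by (simp add: sum.reindex_bij_betw[OF h, symmetric])
      then show "k \<in> weighted_colourings P w m"
        using g k hP by (auto simp: weighted_colourings_def PiE_iff)
    qed
    show "?G ` weighted_colourings P w m \<subseteq> weighted_colourings Q v m"
    proof
      fix k assume "k \<in> ?G ` weighted_colourings P w m"
      then obtain g where g: "g \<in> P \<rightarrow>\<^sub>E {1..}" "(\<Sum>x\<in>P. Poly_Mapping.single (g x) (w x)) = m"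
        and k: "k = ?G g"
        by (auto simp: weighted_colourings_def)
      have "(\<Sum>y\<in>Q. Poly_Mapping.single (k y) (v y)) = (\<Sum>x\<in>P. Poly_Mapping.single (g x) (w x))"
        using k w hP by (simp add: sum.reindex_bij_betw[OF h, symmetric])
      then show "k \<in> weighted_colourings Q v m"
        using g k iQ by (auto simp: weighted_colourings_def PiE_iff)
    qed
  qed
  then show ?thesis
    by (rule bij_betw_same_card[symmetric])
qed

lemma image_mset_nth_sorted_list:
  "image_mset ((!) (sorted_list_of_multiset M)) (mset_set {..<size M}) = M"
proof -
  let ?xs = "sorted_list_of_multiset M"
  have len: "length ?xs = size M"
    by (metis mset_sorted_list_of_multiset size_mset)
  have "image_mset ((!) ?xs) (mset_set {..<size M}) = mset (map ((!) ?xs) [0..<length ?xs])"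
    by (simp add: len atLeast0LessThan mset_upt)
  then show ?thesis
    by (simp only: map_nth mset_sorted_list_of_multiset)
qed

lemma card_weighted_colourings:
  assumes "finite P"
  shows "card (weighted_colourings P w m) = power_sum_coeff (image_mset w (mset_set P)) m"
proof -
  let ?M = "image_mset w (mset_set P)"
  obtain h where "bij_betw h P {..<size ?M}"
    "\<forall>x\<in>P. sorted_list_of_multiset ?M ! h x = w x"
    using bij_betw_of_image_mset_eq[OF assms finite_lessThan image_mset_nth_sorted_list[symmetric]]
    by blast
  then show ?thesis
    unfolding power_sum_coeff_def by (intro card_weighted_colourings_bij_betw) auto
qed

text \<open>A positive weight forces the colour of its element into the finite support of m; a
  weight zero would leave that colour unrestricted.\<close>

lemma finite_weighted_colourings:
  assumes "finite P" "\<And>x. x \<in> P \<Longrightarrow> w x > 0"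
  shows "finite (weighted_colourings P w m)"
proof (rule finite_subset)
  show "finite (P \<rightarrow>\<^sub>E Poly_Mapping.keys m)"
    using assms(1) by (intro finite_PiE) auto
  show "weighted_colourings P w m \<subseteq> P \<rightarrow>\<^sub>E Poly_Mapping.keys m"
  proof
    fix g assume g: "g \<in> weighted_colourings P w m"
    have "g x \<in> Poly_Mapping.keys m" if x: "x \<in> P" for x
    proof -
      have "w x = Poly_Mapping.lookup (Poly_Mapping.single (g x) (w x)) (g x)"
        by simp
      also have "\<dots> \<le> (\<Sum>y\<in>P. Poly_Mapping.lookup (Poly_Mapping.single (g y) (w y)) (g x))"
        using assms(1) x by (intro member_le_sum) auto
      also have "\<dots> = Poly_Mapping.lookup m (g x)"
        using g by (auto simp: weighted_colourings_def lookup_sum)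
      finally show ?thesis
        using assms(2)[OF x] by (simp add: in_keys_iff)
    qed
    then show "g \<in> P \<rightarrow>\<^sub>E Poly_Mapping.keys m"
      using g by (auto simp: weighted_colourings_def PiE_iff)
  qed
qed

lemma lookup_sum_single_inj_on:
  assumes "finite P" "inj_on g P" "x \<in> P"
  shows "Poly_Mapping.lookup (\<Sum>y\<in>P. Poly_Mapping.single (g y) (w y)) (g x) = w x"
proof -
  have "Poly_Mapping.lookup (\<Sum>y\<in>P. Poly_Mapping.single (g y) (w y)) (g x) =
      (\<Sum>y\<in>P. if y = x then w y else 0)"
    unfolding lookup_sum
    using assms by (intro sum.cong) (auto simp: lookup_single when_def inj_on_def)
  then show ?thesis using assms by simp
qed

text \<open>Distinct colours on \<open>Q\<close> display its weights as the nonzero exponents. The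
  colours of \<open>P\<close> must reach all of them, and since \<open>P\<close> is no larger than
  \<open>Q\<close>, each is reached exactly once; the exponents are then the weights of
  \<open>P\<close> as well.\<close>

lemma sum_single_eq_imp_image_mset_eq:
  fixes w :: "'a \<Rightarrow> nat" and v :: "'b \<Rightarrow> nat"
  assumes fin: "finite P" "finite Q" and card: "card P \<le> card Q" and inj: "inj_on h Q"
    and v: "\<And>y. y \<in> Q \<Longrightarrow> v y > 0"
    and eq: "(\<Sum>x\<in>P. Poly_Mapping.single (g x) (w x)) = (\<Sum>y\<in>Q. Poly_Mapping.single (h y) (v y))"
  shows "image_mset w (mset_set P) = image_mset v (mset_set Q)"
proof -
  have "h ` Q \<subseteq> g ` P"
  proof clarify
    fix y assume y: "y \<in> Q"
    have "Poly_Mapping.lookup (\<Sum>x\<in>P. Poly_Mapping.single (g x) (w x)) (h y) = v y"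
      using lookup_sum_single_inj_on[OF fin(2) inj y] by (simp add: eq)
    then have "(\<Sum>x\<in>P. Poly_Mapping.lookup (Poly_Mapping.single (g x) (w x)) (h y)) \<noteq> 0"
      using v[OF y] by (simp add: lookup_sum)
    then obtain x where "x \<in> P" "Poly_Mapping.lookup (Poly_Mapping.single (g x) (w x)) (h y) \<noteq> 0"
      by (meson sum.neutral)
    then show "h y \<in> g ` P"
      by (metis image_eqI lookup_single_not_eq)
  qed
  moreover have "card (g ` P) \<le> card (h ` Q)"
    using card_image_le[OF fin(1), of g] card by (simp add: card_image[OF inj])
  ultimately have img: "h ` Q = g ` P"
    using fin by (intro card_seteq) auto
  then have "card (g ` P) = card P"
    using card_image_le[OF fin(1), of g] card card_image[OF inj] by simp
  then have injg: "inj_on g P"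
    using fin(1) by (intro eq_card_imp_inj_on)
  let ?k = "\<lambda>x. the_inv_into Q h (g x)"
  have k: "bij_betw ?k P Q"
  proof -
    have "bij_betw (the_inv_into Q h) (g ` P) Q"
      using inj img by (metis bij_betw_imageI bij_betw_the_inv_into)
    moreover have "bij_betw g P (g ` P)"
      using injg by (simp add: bij_betw_def)
    ultimately show ?thesis
      using bij_betw_trans[of g P "g ` P" "the_inv_into Q h" Q] by (simp add: comp_def)
  qed
  have "v (?k x) = w x" if x: "x \<in> P" for x
  proof -
    have "?k x \<in> Q" using k x by (auto simp: bij_betw_def)
    moreover have "h (?k x) = g x"
      using f_the_inv_into_f[OF inj, of "g x"] img x by auto
    ultimately show ?thesis
      using lookup_sum_single_inj_on[OF fin(1) injg x, of w]
        lookup_sum_single_inj_on[OF fin(2) inj, of "?k x" v] by (simp add: eq)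
  qed
  then show ?thesis
    by (rule image_mset_mset_set_bij_betw[OF k])
qed

text \<open>Among the products of power sums occurring with nonzero coefficient, one with the largest
  number of factors is the only one containing the monomial with its parts as exponents.\<close>

lemma power_sums_linearly_independent:
  fixes c :: "nat multiset \<Rightarrow> int"
  assumes fin: "finite F" and pos: "\<And>M. M \<in> F \<Longrightarrow> 0 \<notin># M"
    and zero: "\<And>m. (\<Sum>M\<in>F. c M * int (power_sum_coeff M m)) = 0"
    and "M \<in> F"
  shows "c M = 0"
proof (rule ccontr)
  assume "c M \<noteq> 0"
  define S where "S = {M \<in> F. c M \<noteq> 0}"
  have S: "finite S" "S \<noteq> {}"
    using fin \<open>M \<in> F\<close> \<open>c M \<noteq> 0\<close> by (auto simp: S_def)
  then have "Max (size ` S) \<in> size ` S"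
    by (intro Max_in) auto
  then obtain L where L: "L \<in> S" "size L = Max (size ` S)"
    by auto
  have maxL: "size N \<le> size L" if "N \<in> S" for N
    using that S(1) L(2) by simp
  \<comment> \<open>The parts of \<open>L\<close> as exponents of distinct variables. The variables
    start at index one because colours do.\<close>
  define m where "m = (\<Sum>i<size L. Poly_Mapping.single (Suc i) (sorted_list_of_multiset L ! i))"
  have nth_pos: "sorted_list_of_multiset N ! i > 0" if "N \<in> F" "i < size N" for N i
  proof -
    have "sorted_list_of_multiset N ! i \<in> set (sorted_list_of_multiset N)"
      using that(2) by (metis mset_sorted_list_of_multiset nth_mem size_mset)
    then have "sorted_list_of_multiset N ! i \<in># N"
      by simp
    then show ?thesis
      using pos[OF that(1)] by (metis gr_zeroI)
  qed
  have LF: "L \<in> F" using L by (simp add: S_def)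
  have "(\<lambda>i\<in>{..<size L}. Suc i) \<in> weighted_colourings {..<size L} ((!) (sorted_list_of_multiset L)) m"
    by (auto simp: weighted_colourings_def m_def)
  then have coeffL: "power_sum_coeff L m > 0"
    unfolding power_sum_coeff_def
    using finite_weighted_colourings[of "{..<size L}" "(!) (sorted_list_of_multiset L)" m] nth_pos[OF LF]
    by (metis card_gt_0_iff empty_iff finite_lessThan lessThan_iff)
  \<comment> \<open>A product that contains m and has a nonzero coefficient has at most as many
    factors as \<open>L\<close>, and by the comparison of exponents it is then \<open>L\<close>
    itself.\<close>
  have other: "c N * int (power_sum_coeff N m) = 0" if N: "N \<in> F - {L}" for N
  proof (rule ccontr)
    assume nz: "c N * int (power_sum_coeff N m) \<noteq> 0"
    then have "N \<in> S" using N by (simp add: S_def)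
    from nz have "weighted_colourings {..<size N} ((!) (sorted_list_of_multiset N)) m \<noteq> {}"
      unfolding power_sum_coeff_def by force
    then obtain g where "(\<Sum>i<size N. Poly_Mapping.single (g i) (sorted_list_of_multiset N ! i)) = m"
      by (auto simp: weighted_colourings_def)
    then have "image_mset ((!) (sorted_list_of_multiset N)) (mset_set {..<size N}) =
        image_mset ((!) (sorted_list_of_multiset L)) (mset_set {..<size L})"
      unfolding m_def using maxL[OF \<open>N \<in> S\<close>] nth_pos[OF LF]
      by (intro sum_single_eq_imp_image_mset_eq[where h = Suc]) auto
    then show False
      using N by (simp only: image_mset_nth_sorted_list) simp
  qed
  have "(\<Sum>M\<in>F. c M * int (power_sum_coeff M m)) =
      c L * int (power_sum_coeff L m) + (\<Sum>M\<in>F - {L}. c M * int (power_sum_coeff M m))"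
    using fin LF by (simp add: sum.remove)
  also have "(\<Sum>M\<in>F - {L}. c M * int (power_sum_coeff M m)) = 0"
    by (rule sum.neutral) (use other in blast)
  finally show False
    using zero[of m] coeffL L by (simp add: S_def)
qed

section \<open>The power sum expansion\<close>

lemma sum_single_const:
  "(\<Sum>x\<in>S. Poly_Mapping.single a (1::nat)) = Poly_Mapping.single a (card S)"
  by (induction S rule: infinite_finite_induct) (simp_all add: single_add[symmetric])

text \<open>A colouring constant on the edges of \<open>A\<close> is constant on components. It
  amounts to a colouring of the components in which each one contributes its order to the exponent
  of its colour.\<close>

lemma card_colourings_constant_on_edges:
  assumes V: "finite V" "\<Union>A \<subseteq> V" and A: "\<forall>e\<in>A. card e = 2"
  shows "card {\<kappa> \<in> V \<rightarrow>\<^sub>E {1..}. (\<Sum>v\<in>V. Poly_Mapping.single (\<kappa> v) 1) = m \<and>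
             (\<forall>e\<in>A. \<forall>x\<in>e. \<forall>y\<in>e. \<kappa> x = \<kappa> y)} =
         power_sum_coeff (component_type V A) m"
    (is "card ?K = _")
proof -
  let ?C = "components V A"
  \<comment> \<open>\<open>?F\<close> spreads the colour of a component over its vertices; the
    inverse \<open>?G\<close> reads the colour at a chosen representative.\<close>
  let ?F = "\<lambda>g. \<lambda>v\<in>V. g (component A v)" and ?G = "\<lambda>\<kappa>. \<lambda>B\<in>?C. \<kappa> (SOME v. v \<in> B)"
  have comp: "component A v \<in> ?C" if "v \<in> V" for v
    using that by (simp add: components_def)
  have some: "(SOME v. v \<in> B) \<in> B" "B \<subseteq> V" "component A (SOME v. v \<in> B) = B" if B: "B \<in> ?C" for B
  proof -
    show *: "(SOME v. v \<in> B) \<in> B"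
      using component_finite(2)[OF V B] by (simp add: some_in_eq)
    show "B \<subseteq> V"
      using B component_subset[OF V(2)] by (auto simp: components_def)
    show "component A (SOME v. v \<in> B) = B"
      using components_fiber[OF V(2) B] * by auto
  qed
  have const: "\<kappa> x = \<kappa> y" if "\<forall>e\<in>A. \<forall>x\<in>e. \<forall>y\<in>e. \<kappa> x = \<kappa> y" "joined A x y" for \<kappa> :: "'a \<Rightarrow> nat" and x y
    using that(2)
  proof (induction rule: joined_induct)
    case (step y z)
    then show ?case using that(1) by (metis insertCI)
  qed simp
  have mon: "(\<Sum>v\<in>V. Poly_Mapping.single (g (component A v)) (1::nat)) =
      (\<Sum>B\<in>?C. Poly_Mapping.single (g B) (card B))" for g :: "'a set \<Rightarrow> nat"
  proof -
    have "(\<Sum>v\<in>V. Poly_Mapping.single (g (component A v)) (1::nat)) =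
        (\<Sum>B\<in>?C. \<Sum>v | v \<in> V \<and> component A v = B. Poly_Mapping.single (g (component A v)) 1)"
      using V(1) by (intro sum.group[symmetric] finite_components) (auto simp: components_def)
    also have "\<dots> = (\<Sum>B\<in>?C. \<Sum>v\<in>B. Poly_Mapping.single (g B) 1)"
    proof (rule sum.cong[OF refl])
      fix B assume "B \<in> ?C"
      have "(\<Sum>v | v \<in> V \<and> component A v = B. Poly_Mapping.single (g (component A v)) (1::nat)) =
          (\<Sum>v | v \<in> V \<and> component A v = B. Poly_Mapping.single (g B) 1)"
        by (rule sum.cong) auto
      then show "(\<Sum>v | v \<in> V \<and> component A v = B. Poly_Mapping.single (g (component A v)) (1::nat)) =
          (\<Sum>v\<in>B. Poly_Mapping.single (g B) 1)"
        by (simp only: components_fiber[OF V(2) \<open>B \<in> ?C\<close>])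
    qed
    finally show ?thesis
      by (simp only: sum_single_const)
  qed
  have "bij_betw ?F (weighted_colourings ?C card m) ?K"
  proof (rule bij_betw_byWitness[where f' = ?G])
    show "\<forall>g\<in>weighted_colourings ?C card m. ?G (?F g) = g"
    proof
      fix g assume g: "g \<in> weighted_colourings ?C card m"
      show "?G (?F g) = g"
      proof
        fix B
        show "?G (?F g) B = g B"
        proof (cases "B \<in> ?C")
          case True
          then show ?thesis using some[OF True] by auto
        next
          case False
          then show ?thesis using g by (auto simp: weighted_colourings_def PiE_iff extensional_def)
        qed
      qed
    qed
    show "\<forall>\<kappa>\<in>?K. ?F (?G \<kappa>) = \<kappa>"
    proof
      fix \<kappa> assume k: "\<kappa> \<in> ?K"
      show "?F (?G \<kappa>) = \<kappa>"
      proof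
        fix v
        show "?F (?G \<kappa>) v = \<kappa> v"
        proof (cases "v \<in> V")
          case True
          have "joined A v (SOME x. x \<in> component A v)"
            using some(1)[OF comp[OF True]] by (simp add: component_def)
          moreover have "\<forall>e\<in>A. \<forall>x\<in>e. \<forall>y\<in>e. \<kappa> x = \<kappa> y"
            using k by blast
          ultimately have "\<kappa> v = \<kappa> (SOME x. x \<in> component A v)"
            by (rule const[rotated])
          then show ?thesis using True comp by simp
        next
          case False
          then show ?thesis using k by (auto simp: PiE_iff extensional_def)
        qed
      qed
    qed
    show "?F ` weighted_colourings ?C card m \<subseteq> ?K"
    proof
      fix \<kappa> assume "\<kappa> \<in> ?F ` weighted_colourings ?C card m"
      then obtain g where g: "g \<in> ?C \<rightarrow>\<^sub>E {1..}" "(\<Sum>B\<in>?C. Poly_Mapping.single (g B) (card B)) = m"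
        and k: "\<kappa> = ?F g"
        by (auto simp: weighted_colourings_def)
      have "\<kappa> x = \<kappa> y" if "e \<in> A" "x \<in> e" "y \<in> e" for e x y
      proof -
        have "x \<in> V" "y \<in> V" using that V(2) by auto
        moreover have "joined A x y"
        proof (cases "x = y")
          case False
          have "card e = 2" using A that(1) by blast
          then obtain a b where e: "e = {a, b}" by (auto simp: card_2_iff)
          have "x \<in> {a, b}" "y \<in> {a, b}" using that(2,3) by (simp_all only: e)
          then have "e = {x, y}" unfolding e using False by blast
          then show ?thesis using that(1) by (simp add: joined_edge)
        qed simp
        ultimately show ?thesis using k by (simp add: component_eq_iff[symmetric])
      qed
      moreover have "(\<Sum>v\<in>V. Poly_Mapping.single (\<kappa> v) 1) = m"
        using mon[of g] g(2) k by simp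
      moreover have "\<kappa> \<in> V \<rightarrow>\<^sub>E {1..}"
        using g(1) k comp by (auto simp: PiE_iff)
      ultimately show "\<kappa> \<in> ?K" by blast
    qed
    show "?G ` ?K \<subseteq> weighted_colourings ?C card m"
    proof
      fix g assume "g \<in> ?G ` ?K"
      then obtain \<kappa> where k: "\<kappa> \<in> ?K" and g: "g = ?G \<kappa>" by auto
      have "g (component A v) = \<kappa> v" if "v \<in> V" for v
      proof -
        have "joined A v (SOME x. x \<in> component A v)"
          using some(1)[OF comp[OF that]] by (simp add: component_def)
        moreover have "\<forall>e\<in>A. \<forall>x\<in>e. \<forall>y\<in>e. \<kappa> x = \<kappa> y"
          using k by blast
        ultimately have "\<kappa> v = \<kappa> (SOME x. x \<in> component A v)"
          by (rule const[rotated])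
        then show ?thesis using that comp g by simp
      qed
      then have "(\<Sum>B\<in>?C. Poly_Mapping.single (g B) (card B)) = m"
        using mon[of g] k by simp
      moreover have "g \<in> ?C \<rightarrow>\<^sub>E {1..}"
      proof (rule PiE_I)
        fix B assume "B \<in> ?C"
        then show "g B \<in> {1..}"
          using g k some(1,2)[of B] by (auto simp: PiE_iff subset_iff)
      qed (use g in auto)
      ultimately show "g \<in> weighted_colourings ?C card m"
        by (simp add: weighted_colourings_def)
    qed
  qed
  then have "card ?K = card (weighted_colourings ?C card m)"
    by (rule bij_betw_same_card[symmetric])
  then show ?thesis
    using V(1) by (simp add: card_weighted_colourings finite_components component_type_def)
qed

text \<open>Stanley's power sum expansion, coefficient by coefficient. Properness is the product
  over all edges of one minus the indicator that the edge is monochromatic; multiplying out and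
  summing over the colourings first gives the right-hand side.\<close>

lemma chromatic_symmetric_function_power_sums:
  assumes G: "finite_simple_graph G"
  shows "chromatic_symmetric_function G m =
    (\<Sum>A\<in>Pow (edges G). (- 1) ^ card A * int (power_sum_coeff (component_type (verts G) A) m))"
proof -
  let ?V = "verts G" and ?E = "edges G"
  define Q where "Q = {\<kappa> \<in> ?V \<rightarrow>\<^sub>E {1..}. (\<Sum>v\<in>?V. Poly_Mapping.single (\<kappa> v) (1::nat)) = m}"
  define monochr where "monochr \<kappa> e \<longleftrightarrow> (\<forall>x\<in>e. \<forall>y\<in>e. \<kappa> x = \<kappa> y)" for \<kappa> :: "'a \<Rightarrow> nat" and e
  have fV: "finite ?V" and E: "\<And>e. e \<in> ?E \<Longrightarrow> e \<subseteq> ?V \<and> card e = 2"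
    using G by (auto simp: finite_simple_graph_def)
  have fE: "finite ?E" using G by (rule finite_edges)
  \<comment> \<open>\<open>Q\<close> holds all colourings with monomial m, proper or not. It is
    finite because every vertex has weight one.\<close>
  have "Q = weighted_colourings ?V (\<lambda>_. 1) m"
    by (simp add: Q_def weighted_colourings_def)
  then have fQ: "finite Q"
    using finite_weighted_colourings[OF fV, of "\<lambda>_. 1" m] by simp
  have proper: "(\<forall>u\<in>?V. \<forall>v\<in>?V. adjacent G u v \<longrightarrow> \<kappa> u \<noteq> \<kappa> v) \<longleftrightarrow> (\<forall>e\<in>?E. \<not> monochr \<kappa> e)" for \<kappa>
  proof
    assume *: "\<forall>u\<in>?V. \<forall>v\<in>?V. adjacent G u v \<longrightarrow> \<kappa> u \<noteq> \<kappa> v"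
    show "\<forall>e\<in>?E. \<not> monochr \<kappa> e"
    proof
      fix e assume e: "e \<in> ?E"
      then obtain a b where ab: "e = {a, b}" using E by (metis card_2_iff)
      then have "\<kappa> a \<noteq> \<kappa> b" using * e E[OF e] by (auto simp: adjacent_def)
      then show "\<not> monochr \<kappa> e" using ab by (auto simp: monochr_def)
    qed
  next
    assume *: "\<forall>e\<in>?E. \<not> monochr \<kappa> e"
    show "\<forall>u\<in>?V. \<forall>v\<in>?V. adjacent G u v \<longrightarrow> \<kappa> u \<noteq> \<kappa> v"
    proof (intro ballI impI)
      fix u v assume "adjacent G u v"
      then have "\<not> monochr \<kappa> {u, v}" using * by (simp add: adjacent_def)
      then show "\<kappa> u \<noteq> \<kappa> v" by (auto simp: monochr_def)
    qed
  qed
  have expand: "of_bool (\<forall>e\<in>?E. \<not> monochr \<kappa> e) =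
      (\<Sum>A\<in>Pow ?E. (- 1) ^ card A * of_bool (\<forall>e\<in>A. monochr \<kappa> e) :: int)" for \<kappa>
  proof -
    have pr: "(\<Prod>e\<in>A. of_bool (R e)) = (of_bool (\<forall>e\<in>A. R e) :: int)"
      if "finite A" for A :: "'a set set" and R
      using that by (induction A rule: finite_induct) auto
    have "of_bool (\<forall>e\<in>?E. \<not> monochr \<kappa> e) = (\<Prod>e\<in>?E. of_bool (\<not> monochr \<kappa> e) :: int)"
      using fE by (simp add: pr)
    also have "\<dots> = (\<Prod>e\<in>?E. 1 - of_bool (monochr \<kappa> e))"
      by (intro prod.cong) auto
    \<comment> \<open>This is inclusion-exclusion: choosing from each factor either 1 or the negated
      indicator selects an edge subset \<open>A\<close>.\<close>
    also have "\<dots> = (\<Sum>A\<in>Pow ?E. (- 1) ^ card A * (\<Prod>e\<in>A. of_bool (monochr \<kappa> e)) * (\<Prod>e\<in>?E - A. 1))"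
      by (rule prod_diff_conv_sum) (rule fE)
    also have "\<dots> = (\<Sum>A\<in>Pow ?E. (- 1) ^ card A * of_bool (\<forall>e\<in>A. monochr \<kappa> e))"
      using fE by (intro sum.cong) (auto simp: pr finite_subset)
    finally show ?thesis .
  qed
  have "{\<kappa> \<in> proper_colourings G. colouring_monomial G \<kappa> = m} = {\<kappa> \<in> Q. \<forall>e\<in>?E. \<not> monochr \<kappa> e}"
    unfolding proper_colourings_def proper Q_def colouring_monomial_def by blast
  then have "chromatic_symmetric_function G m = int (card {\<kappa> \<in> Q. \<forall>e\<in>?E. \<not> monochr \<kappa> e})"
    by (simp add: chromatic_symmetric_function_def)
  also have "\<dots> = (\<Sum>\<kappa>\<in>Q. of_bool (\<forall>e\<in>?E. \<not> monochr \<kappa> e))"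
    using fQ by (simp add: sum_of_bool_eq Int_def)
  also have "\<dots> = (\<Sum>A\<in>Pow ?E. \<Sum>\<kappa>\<in>Q. (- 1) ^ card A * of_bool (\<forall>e\<in>A. monochr \<kappa> e))"
    unfolding expand by (rule sum.swap)
  also have "\<dots> = (\<Sum>A\<in>Pow ?E. (- 1) ^ card A * int (card {\<kappa> \<in> Q. \<forall>e\<in>A. monochr \<kappa> e}))"
    using fQ by (intro sum.cong) (simp_all add: sum_of_bool_eq Int_def flip: sum_distrib_left)
  also have "\<dots> = (\<Sum>A\<in>Pow ?E. (- 1) ^ card A * int (power_sum_coeff (component_type ?V A) m))"
  proof (rule sum.cong[OF refl])
    fix A assume A: "A \<in> Pow ?E"
    have "{\<kappa> \<in> Q. \<forall>e\<in>A. monochr \<kappa> e} =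
        {\<kappa> \<in> ?V \<rightarrow>\<^sub>E {1..}. (\<Sum>v\<in>?V. Poly_Mapping.single (\<kappa> v) 1) = m \<and>
             (\<forall>e\<in>A. \<forall>x\<in>e. \<forall>y\<in>e. \<kappa> x = \<kappa> y)}"
      unfolding Q_def monochr_def by blast
    moreover have "\<Union>A \<subseteq> ?V" "\<forall>e\<in>A. card e = 2"
      using A E by auto
    ultimately show "(- 1) ^ card A * int (card {\<kappa> \<in> Q. \<forall>e\<in>A. monochr \<kappa> e}) =
        (- 1) ^ card A * int (power_sum_coeff (component_type ?V A) m)"
      by (simp only: card_colourings_constant_on_edges[OF fV])
  qed
  finally show ?thesis .
qed

text \<open>In a tree the sign of an edge subset is determined by its type, so that nothing cancels.\<close>

lemma chromatic_symmetric_function_determines_types: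
  assumes T: "tree T" "tree T'"
    and eq: "chromatic_symmetric_function T' = chromatic_symmetric_function T"
  shows "\<exists>\<phi>. bij_betw \<phi> (Pow (edges T)) (Pow (edges T')) \<and>
    (\<forall>A\<in>Pow (edges T). component_type (verts T') (\<phi> A) = component_type (verts T) A)"
proof -
  let ?t = "component_type (verts T)" and ?t' = "component_type (verts T')"
  let ?P = "Pow (edges T)" and ?P' = "Pow (edges T')"
  have sg: "finite_simple_graph T" "finite_simple_graph T'"
    using T by (auto simp: tree_def)
  then have fin: "finite ?P" "finite ?P'" by (auto intro: finite_edges)
  \<comment> \<open>All types that occur in either tree: a common finite index set on which the two
    expansions can be compared.\<close>
  define F where "F = ?t ` ?P \<union> ?t' ` ?P'"
  \<comment> \<open>The coefficient of the product of power sums indexed by M, as a signed count of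
    the edge subsets of type M.\<close>
  define c where "c M = (\<Sum>A | A \<in> ?P \<and> ?t A = M. (- 1 :: int) ^ card A)" for M
  define c' where "c' M = (\<Sum>A | A \<in> ?P' \<and> ?t' A = M. (- 1 :: int) ^ card A)" for M
  have finF: "finite F" using fin by (auto simp: F_def)
  have zero_notin: "0 \<notin># component_type (verts G) A"
    if "finite_simple_graph G" "A \<in> Pow (edges G)" for G :: "'x graph" and A
    using component_type_pos[of "verts G" A 0] edges_subset_verts[of G A] that
    by (auto simp: finite_simple_graph_def)
  have pos: "0 \<notin># M" if "M \<in> F" for M
    using that zero_notin[OF sg(1)] zero_notin[OF sg(2)] by (auto simp: F_def)
  have cT: "(\<Sum>M\<in>F. c M * int (power_sum_coeff M m)) = chromatic_symmetric_function T m" for m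
  proof -
    have "(\<Sum>M\<in>F. c M * int (power_sum_coeff M m)) =
        (\<Sum>M\<in>F. \<Sum>A | A \<in> ?P \<and> ?t A = M. (- 1) ^ card A * int (power_sum_coeff (?t A) m))"
      unfolding c_def sum_distrib_right by (intro sum.cong) auto
    also have "\<dots> = (\<Sum>A\<in>?P. (- 1) ^ card A * int (power_sum_coeff (?t A) m))"
      by (rule sum.group) (use fin finF in \<open>auto simp: F_def\<close>)
    finally show ?thesis
      by (simp add: chromatic_symmetric_function_power_sums[OF sg(1)])
  qed
  have cT': "(\<Sum>M\<in>F. c' M * int (power_sum_coeff M m)) = chromatic_symmetric_function T' m" for m
  proof -
    have "(\<Sum>M\<in>F. c' M * int (power_sum_coeff M m)) =
        (\<Sum>M\<in>F. \<Sum>A | A \<in> ?P' \<and> ?t' A = M. (- 1) ^ card A * int (power_sum_coeff (?t' A) m))"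
      unfolding c'_def sum_distrib_right by (intro sum.cong) auto
    also have "\<dots> = (\<Sum>A\<in>?P'. (- 1) ^ card A * int (power_sum_coeff (?t' A) m))"
      by (rule sum.group) (use fin finF in \<open>auto simp: F_def\<close>)
    finally show ?thesis
      by (simp add: chromatic_symmetric_function_power_sums[OF sg(2)])
  qed
  have "(\<Sum>M\<in>F. (c M - c' M) * int (power_sum_coeff M m)) = 0" for m
    using cT[of m] cT'[of m] eq by (simp add: left_diff_distrib sum_subtractf)
  then have cc: "c M = c' M" if "M \<in> F" for M
    using power_sums_linearly_independent[OF finF pos, of "\<lambda>M. c M - c' M" M] that by simp
  \<comment> \<open>All edge subsets of one type have the same size, so their signs agree and the
    absolute value of the coefficient counts them. Absolute values also make it unnecessary to
    compare the signs of the two trees.\<close>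
  have abs_sum: "\<bar>\<Sum>A | A \<in> Pow (edges G) \<and> component_type (verts G) A = M. (- 1 :: int) ^ card A\<bar> =
      int (card {A \<in> Pow (edges G). component_type (verts G) A = M})"
    if "tree G" for G :: "'x graph" and M
  proof -
    have "(- 1 :: int) ^ card A = (- 1) ^ (card (verts G) + size M)"
      if "A \<in> Pow (edges G) \<and> component_type (verts G) A = M" for A
    proof -
      have "card A + size M = card (verts G)"
        using card_plus_size_component_type[OF \<open>tree G\<close>, of A] that by auto
      then have "even (card A) = even (card (verts G) + size M)" by presburger
      then show ?thesis by (simp add: minus_one_power_iff)
    qed
    then have "(\<Sum>A | A \<in> Pow (edges G) \<and> component_type (verts G) A = M. (- 1 :: int) ^ card A) =
        int (card {A \<in> Pow (edges G). component_type (verts G) A = M}) *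
          (- 1) ^ (card (verts G) + size M)"
      by simp
    then show ?thesis by (simp add: abs_mult power_abs)
  qed
  have "card {A \<in> ?P. ?t A = M} = card {A \<in> ?P'. ?t' A = M}" for M
  proof (cases "M \<in> F")
    case True
    then have "\<bar>c M\<bar> = \<bar>c' M\<bar>" by (simp add: cc)
    then show ?thesis
      unfolding c_def c'_def abs_sum[OF T(1)] abs_sum[OF T(2)] by simp
  next
    case False
    then have "{A \<in> ?P. ?t A = M} = {}" "{A \<in> ?P'. ?t' A = M} = {}"
      by (auto simp: F_def)
    then show ?thesis by (simp only: card.empty)
  qed
  then have "image_mset ?t (mset_set ?P) = image_mset ?t' (mset_set ?P')"
    by (rule image_mset_mset_set_eqI[OF fin])
  then show ?thesis
    by (rule bij_betw_of_image_mset_eq[OF fin])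
qed

section \<open>Leaves and the internal core\<close>

definition leaf_edges :: "'a graph \<Rightarrow> 'a set set" where
  "leaf_edges G = {e \<in> edges G. \<exists>v\<in>e. is_leaf G v}"

lemma verts_internal_core [simp]: "verts (internal_core G) = {v \<in> verts G. \<not> is_leaf G v}"
  by (auto simp: internal_core_def induced_subgraph_def)

lemma edge_doubleton:
  assumes "finite_simple_graph G" "e \<in> edges G" "v \<in> e"
  obtains w where "e = {v, w}" "v \<noteq> w" "w \<in> verts G" "v \<in> verts G"
proof -
  have "card e = 2" "e \<subseteq> verts G"
    using assms by (auto simp: finite_simple_graph_def)
  from this(1) obtain a b where "e = {a, b}" "a \<noteq> b"
    by (auto simp: card_2_iff)
  then show thesis
    using that[of a] that[of b] assms(3) \<open>e \<subseteq> verts G\<close> by (auto simp: insert_commute)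
qed

lemma edges_internal_core:
  assumes "finite_simple_graph G"
  shows "edges (internal_core G) = edges G - leaf_edges G"
proof -
  have "e \<subseteq> {v \<in> verts G. \<not> is_leaf G v} \<longleftrightarrow> \<not> (\<exists>v\<in>e. is_leaf G v)" if "e \<in> edges G" for e
    using edges_subset_verts[OF assms subset_refl] that by blast
  then show ?thesis
    unfolding internal_core_def induced_subgraph_def leaf_edges_def by auto
qed

lemma finite_simple_graph_internal_core:
  "finite_simple_graph G \<Longrightarrow> finite_simple_graph (internal_core G)"
  by (auto simp: finite_simple_graph_def internal_core_def induced_subgraph_def)

lemma adjacent_sym: "adjacent G u v \<longleftrightarrow> adjacent G v u"
  by (simp add: adjacent_def insert_commute)

lemma adjacentD:
  assumes "finite_simple_graph G" "adjacent G u v"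
  shows "u \<in> verts G" "v \<in> verts G" "u \<noteq> v"
  using assms by (auto simp: adjacent_def finite_simple_graph_def)

lemma degree_eq_card_edges:
  assumes "finite_simple_graph G"
  shows "degree G v = card {e \<in> edges G. v \<in> e}"
proof -
  have "bij_betw (\<lambda>u. {u, v}) {u \<in> verts G. adjacent G u v} {e \<in> edges G. v \<in> e}"
    unfolding bij_betw_def
  proof (intro conjI set_eqI iffI)
    show "inj_on (\<lambda>u. {u, v}) {u \<in> verts G. adjacent G u v}"
      by (auto simp: inj_on_def doubleton_eq_iff)
    fix e assume "e \<in> {e \<in> edges G. v \<in> e}"
    then show "e \<in> (\<lambda>u. {u, v}) ` {u \<in> verts G. adjacent G u v}"
      using edge_doubleton[OF assms, of e v] by (auto simp: adjacent_def insert_commute)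
  qed (auto simp: adjacent_def)
  then show ?thesis
    by (simp add: degree_def bij_betw_same_card)
qed

lemma leaf_unique_neighbour:
  assumes "finite_simple_graph G" "is_leaf G u"
  shows "\<exists>!w. adjacent G w u"
proof -
  obtain w where w: "{x \<in> verts G. adjacent G x u} = {w}"
    using assms(2) by (auto simp: is_leaf_def degree_def card_1_singleton_iff)
  then show ?thesis
    using adjacentD(1)[OF assms(1)] by (intro ex1I[of _ w]) blast+
qed

lemma connected_graph_closed_subset:
  assumes "connected_graph G" "S \<subseteq> verts G" "S \<noteq> {}"
    and closed: "\<And>x y. x \<in> S \<Longrightarrow> adjacent G x y \<Longrightarrow> y \<in> S"
  shows "S = verts G"
proof
  obtain s where s: "s \<in> S" using assms(3) by auto
  show "verts G \<subseteq> S"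
  proof
    fix v assume "v \<in> verts G"
    then have "(adjacent G)\<^sup>*\<^sup>* s v"
      using assms(1,2) s by (auto simp: connected_graph_def)
    then show "v \<in> S"
      by (induction rule: rtranclp_induct) (use s closed in auto)
  qed
qed (rule assms(2))

text \<open>This expresses that the core is connected. Adjoining to \<open>S\<close> the leaves
  attached to it gives a set closed under adjacency in the whole graph, since a leaf leads back only
  to its one neighbour.\<close>

lemma internal_core_closed_subset:
  assumes "finite_simple_graph G" "connected_graph G" "S \<subseteq> verts (internal_core G)" "S \<noteq> {}"
    and closed: "\<And>x y. x \<in> S \<Longrightarrow> y \<in> verts (internal_core G) \<Longrightarrow> adjacent G x y \<Longrightarrow> y \<in> S"
  shows "S = verts (internal_core G)"
proof -
  let ?S = "S \<union> {u. is_leaf G u \<and> (\<exists>s\<in>S. adjacent G s u)}"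
  have "?S = verts G"
  proof (rule connected_graph_closed_subset[OF assms(2)])
    show "?S \<subseteq> verts G" using assms(3) by (auto simp: is_leaf_def)
    show "?S \<noteq> {}" using assms(4) by auto
    fix x y assume x: "x \<in> ?S" and xy: "adjacent G x y"
    have y: "y \<in> verts G" using adjacentD[OF assms(1) xy] by simp
    show "y \<in> ?S"
    proof (cases "x \<in> S")
      case True
      then show ?thesis using closed[of x y] xy y by auto
    next
      case False
      then obtain s where s: "s \<in> S" "is_leaf G x" "adjacent G s x" using x by auto
      then have "y = s"
        using leaf_unique_neighbour[OF assms(1) s(2)] xy adjacent_sym by metis
      then show ?thesis using s by simp
    qed
  qed
  then show ?thesis using assms(3) by auto
qed

lemma connected_verts_subset_edges:
  assumes "finite_simple_graph G" "connected_graph G" "card (verts G) \<ge> 2"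
  shows "verts G \<subseteq> \<Union>(edges G)"
proof (rule ccontr)
  assume "\<not> verts G \<subseteq> \<Union>(edges G)"
  then obtain v where v: "v \<in> verts G" "v \<notin> \<Union>(edges G)" by auto
  then have "{v} = verts G"
    by (intro connected_graph_closed_subset[OF assms(2)]) (auto simp: adjacent_def)
  then show False using assms(3) by (metis card_1_singleton_iff One_nat_def not_less_eq_eq numeral_2_eq_2 order_refl)
qed

text \<open>A tree on at most two vertices is complete, so its order determines it. This disposes of
  the trees below three vertices, among them the single edge, whose core is empty.\<close>

lemma small_tree_adjacent_iff:
  assumes "tree G" "card (verts G) \<le> 2" "u \<in> verts G" "v \<in> verts G"
  shows "adjacent G u v \<longleftrightarrow> u \<noteq> v"
proof
  have sg: "finite_simple_graph G" using assms(1) by (simp add: tree_def)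
  show "u \<noteq> v" if "adjacent G u v" using adjacentD[OF sg that] by simp
  assume "u \<noteq> v"
  then have "card {u, v} = 2" by simp
  moreover have "finite (verts G)" using sg by (simp add: finite_simple_graph_def)
  ultimately have V: "{u, v} = verts G"
    using assms by (intro card_seteq) auto
  then have "card (verts G) = 2" using \<open>card {u, v} = 2\<close> by simp
  then have "verts G \<subseteq> \<Union>(edges G)"
    using connected_verts_subset_edges[of G] assms(1) by (simp add: tree_def)
  then obtain e where e: "e \<in> edges G" "u \<in> e" using assms(3) by auto
  then obtain w where "e = {u, w}" "u \<noteq> w" "w \<in> verts G"
    using edge_doubleton[OF sg] by metis
  moreover from this V have "w \<in> {u, v}" by simp
  ultimately have "e = {u, v}" by auto
  then show "adjacent G u v" using e by (simp add: adjacent_def)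
qed

text \<open>Two adjacent leaves have no further neighbours and would form the whole connected
  graph.\<close>

lemma leaf_neighbour_not_leaf:
  assumes "finite_simple_graph G" "connected_graph G" "card (verts G) \<ge> 3"
    and "is_leaf G u" "adjacent G u w"
  shows "\<not> is_leaf G w"
proof
  assume "is_leaf G w"
  have nb: "y = w" if "adjacent G u y" for y
    using leaf_unique_neighbour[OF assms(1,4)] assms(5) that adjacent_sym by metis
  have nb': "y = u" if "adjacent G w y" for y
    using leaf_unique_neighbour[OF assms(1) \<open>is_leaf G w\<close>] assms(5) that adjacent_sym by metis
  have "{u, w} = verts G"
  proof (rule connected_graph_closed_subset[OF assms(2)])
    show "{u, w} \<subseteq> verts G" using adjacentD[OF assms(1,5)] by simp
  qed (use nb nb' in auto)
  then have "card (verts G) = card {u, w}" by simp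
  also have "\<dots> \<le> 2" by (simp add: card_insert_if)
  finally show False using assms(3) by simp
qed

text \<open>A leaf lies on a single edge, so every cover has to use that edge.\<close>

lemma leaf_edges_subset_cover:
  assumes "finite_simple_graph G" "A \<subseteq> edges G" "verts G \<subseteq> \<Union>A"
  shows "leaf_edges G \<subseteq> A"
proof
  fix e assume "e \<in> leaf_edges G"
  then obtain u where e: "e \<in> edges G" "u \<in> e" "is_leaf G u"
    by (auto simp: leaf_edges_def)
  then obtain e' where e': "e' \<in> A" "u \<in> e'"
    using assms(3) by (auto simp: is_leaf_def)
  have "card {e \<in> edges G. u \<in> e} = 1"
    using e(3) degree_eq_card_edges[OF assms(1), of u] by (simp add: is_leaf_def)
  then obtain d where "{e \<in> edges G. u \<in> e} = {d}"
    by (metis card_1_singletonE)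
  moreover have "e \<in> {e \<in> edges G. u \<in> e}" "e' \<in> {e \<in> edges G. u \<in> e}"
    using e e' assms(2) by auto
  ultimately have "e = e'" by simp
  then show "e \<in> A" using e' by simp
qed

text \<open>Without its only edge a leaf is uncovered, whereas a nonleaf end of e lies on a second
  edge and stays covered.\<close>

lemma remove_edge_cover_iff:
  assumes "finite_simple_graph G" "connected_graph G" "card (verts G) \<ge> 2" "e \<in> edges G"
  shows "verts G \<subseteq> \<Union>(edges G - {e}) \<longleftrightarrow> e \<notin> leaf_edges G"
proof
  assume "verts G \<subseteq> \<Union>(edges G - {e})"
  then show "e \<notin> leaf_edges G"
    using leaf_edges_subset_cover[OF assms(1), of "edges G - {e}"] by auto
next
  assume ne: "e \<notin> leaf_edges G"
  show "verts G \<subseteq> \<Union>(edges G - {e})"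
  proof
    fix v assume v: "v \<in> verts G"
    then obtain d where d: "d \<in> edges G" "v \<in> d"
      using connected_verts_subset_edges[OF assms(1-3)] by auto
    show "v \<in> \<Union>(edges G - {e})"
    proof (cases "v \<in> e")
      case True
      then have "\<not> is_leaf G v"
        using ne assms(4) by (auto simp: leaf_edges_def)
      then have "card {e \<in> edges G. v \<in> e} \<noteq> 1"
        using v degree_eq_card_edges[OF assms(1), of v] by (simp add: is_leaf_def)
      then have "{d \<in> edges G. v \<in> d} \<noteq> {e}"
        by (metis card.empty card_insert_disjoint One_nat_def empty_iff finite.emptyI)
      moreover have "e \<in> {d \<in> edges G. v \<in> d}"
        using True assms(4) by simp
      ultimately obtain d where "d \<in> edges G" "v \<in> d" "d \<noteq> e"
        by blast
      then show ?thesis by blast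
    next
      case False
      then show ?thesis using d by auto
    qed
  qed
qed

text \<open>This makes the number of leaf edges visible in the cover counts of any tree with at
  least two vertices, and so also in \<open>T'\<close>, about which properness is not known.\<close>

lemma card_covers_missing_one_edge:
  assumes "finite_simple_graph G" "connected_graph G" "card (verts G) \<ge> 2"
  shows "card {A \<in> Pow (edges G). Suc (card A) = card (edges G) \<and> verts G \<subseteq> \<Union>A} =
         card (edges G - leaf_edges G)"
proof -
  have fE: "finite (edges G)" using assms(1) by (rule finite_edges)
  have "bij_betw (\<lambda>e. edges G - {e}) (edges G - leaf_edges G)
      {A \<in> Pow (edges G). Suc (card A) = card (edges G) \<and> verts G \<subseteq> \<Union>A}"
    unfolding bij_betw_def
  proof (intro conjI set_eqI iffI)
    show "inj_on (\<lambda>e. edges G - {e}) (edges G - leaf_edges G)"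
      by (auto simp: inj_on_def)
  next
    fix A assume "A \<in> (\<lambda>e. edges G - {e}) ` (edges G - leaf_edges G)"
    then obtain e where e: "e \<in> edges G" "e \<notin> leaf_edges G" "A = edges G - {e}" by auto
    then have "Suc (card A) = card (edges G)"
      using card_Suc_Diff1[OF fE e(1)] by simp
    then show "A \<in> {A \<in> Pow (edges G). Suc (card A) = card (edges G) \<and> verts G \<subseteq> \<Union>A}"
      using e remove_edge_cover_iff[OF assms e(1)] by auto
  next
    fix A assume A: "A \<in> {A \<in> Pow (edges G). Suc (card A) = card (edges G) \<and> verts G \<subseteq> \<Union>A}"
    then have "card (edges G - A) = 1"
      using fE by (auto simp: card_Diff_subset finite_subset)
    then obtain e where e: "edges G - A = {e}" by (metis card_1_singletonE)
    then have "A = edges G - {e}" "e \<in> edges G" using A by auto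
    moreover from this have "e \<notin> leaf_edges G"
      using A remove_edge_cover_iff[OF assms, of e] by simp
    ultimately show "A \<in> (\<lambda>e. edges G - {e}) ` (edges G - leaf_edges G)" by auto
  qed
  then show ?thesis by (rule bij_betw_same_card[symmetric])
qed

text \<open>Here properness enters: a leaf is covered by its own edge, a nonleaf vertex by the edge
  to one of its leaves.\<close>

lemma proper_tree_leaf_edges_cover:
  assumes "proper_tree T" "card (verts T) \<ge> 2"
  shows "verts T \<subseteq> \<Union>(leaf_edges T)"
proof
  have T: "finite_simple_graph T" "connected_graph T"
    using assms(1) by (auto simp: proper_tree_def tree_def)
  fix v assume v: "v \<in> verts T"
  show "v \<in> \<Union>(leaf_edges T)"
  proof (cases "is_leaf T v")
    case True
    then obtain e where "e \<in> edges T" "v \<in> e"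
      using connected_verts_subset_edges[OF T assms(2)] v by auto
    then show ?thesis using True by (auto simp: leaf_edges_def)
  next
    case False
    then obtain u where "is_leaf T u" "adjacent T u v"
      using assms(1) v by (auto simp: proper_tree_def)
    then show ?thesis by (auto simp: leaf_edges_def adjacent_def intro!: bexI[of _ "{u, v}"])
  qed
qed

text \<open>From the centre leaf edges lead only to leaves, and from a leaf the only way on is back
  to the centre, so no walk leaves the star.\<close>

lemma component_leaf_edges:
  assumes "finite_simple_graph G" "connected_graph G" "card (verts G) \<ge> 3"
    and v: "v \<in> verts (internal_core G)"
  shows "component (leaf_edges G) v = insert v {u \<in> verts G. is_leaf G u \<and> adjacent G u v}"
    (is "_ = insert v ?L")
proof (intro set_eqI iffI)
  fix x assume "x \<in> component (leaf_edges G) v"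
  then have "joined (leaf_edges G) v x" by (simp add: component_def)
  then show "x \<in> insert v ?L"
  proof (induction rule: joined_induct)
    case (step y z)
    have yz: "adjacent G y z" "is_leaf G y \<or> is_leaf G z"
      using step.hyps(2) by (auto simp: leaf_edges_def adjacent_def)
    show ?case
    proof (cases "y = v")
      case True
      then show ?thesis
        using yz v adjacentD[OF assms(1) yz(1)] adjacent_sym[of G] by auto
    next
      case False
      then have "is_leaf G y" "adjacent G y v" using step.IH by auto
      then have "z = v"
        using leaf_unique_neighbour[OF assms(1) \<open>is_leaf G y\<close>] yz(1) adjacent_sym by metis
      then show ?thesis by simp
    qed
  qed simp
next
  fix x assume "x \<in> insert v ?L"
  then consider "x = v" | "is_leaf G x" "adjacent G x v" by auto
  then show "x \<in> component (leaf_edges G) v"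
  proof cases
    case 2
    then have "{v, x} \<in> leaf_edges G"
      by (auto simp: leaf_edges_def adjacent_def insert_commute)
    then show ?thesis by (simp add: component_def joined_edge)
  qed simp
qed

lemma card_component_leaf_edges:
  assumes "finite_simple_graph G" "connected_graph G" "card (verts G) \<ge> 3"
    and v: "v \<in> verts (internal_core G)"
  shows "card (component (leaf_edges G) v) = leaf_weight G v"
proof -
  have "finite (verts G)" using assms(1) by (simp add: finite_simple_graph_def)
  moreover have "v \<notin> {u \<in> verts G. is_leaf G u \<and> adjacent G u v}" using v by simp
  ultimately show ?thesis
    by (simp only: component_leaf_edges[OF assms] leaf_weight_def) simp
qed

text \<open>Each leaf component contains exactly one core vertex: all other members of the star are
  leaves, and a leaf lies in the star of its neighbour, which belongs to the core. So the core
  indexes the components without repetition.\<close>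

lemma component_type_leaf_edges:
  assumes G: "finite_simple_graph G" "connected_graph G" "card (verts G) \<ge> 3"
  shows "component_type (verts G) (leaf_edges G) =
         image_mset (leaf_weight G) (mset_set (verts (internal_core G)))"
proof -
  let ?C = "verts (internal_core G)" and ?c = "component (leaf_edges G)"
  have inj: "inj_on ?c ?C"
  proof (rule inj_onI)
    fix x y assume xy: "x \<in> ?C" "y \<in> ?C" "?c x = ?c y"
    then have "x \<in> ?c y" using component_self[of x "leaf_edges G"] by simp
    then show "x = y"
      using xy(1) by (simp add: component_leaf_edges[OF G xy(2)])
  qed
  have "components (verts G) (leaf_edges G) = ?c ` ?C"
  proof (intro set_eqI iffI)
    fix B assume "B \<in> components (verts G) (leaf_edges G)"
    then obtain v where v: "v \<in> verts G" "B = ?c v" by (auto simp: components_def)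
    show "B \<in> ?c ` ?C"
    proof (cases "is_leaf G v")
      case True
      then obtain w where w: "adjacent G v w"
        using leaf_unique_neighbour[OF G(1) True] adjacent_sym by metis
      then have "w \<in> ?C"
        using leaf_neighbour_not_leaf[OF G True w] adjacentD[OF G(1) w] by simp
      moreover have "v \<in> ?c w"
        using True w v by (simp add: component_leaf_edges[OF G \<open>w \<in> ?C\<close>])
      then have "?c v = ?c w" by (rule component_eqI)
      ultimately show ?thesis using v by blast
    next
      case False
      then show ?thesis using v by auto
    qed
  qed (auto simp: components_def)
  then have "component_type (verts G) (leaf_edges G) = image_mset card (image_mset ?c (mset_set ?C))"
    by (simp only: component_type_def image_mset_mset_set[OF inj])
  also have "\<dots> = image_mset (leaf_weight G) (mset_set ?C)"
    unfolding multiset.map_comp comp_def using G(1)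
    by (intro image_mset_cong card_component_leaf_edges[OF G]) (auto simp: finite_simple_graph_def)
  finally show ?thesis .
qed

lemma internal_core_incident_edge:
  assumes "finite_simple_graph G" "connected_graph G" "card (verts (internal_core G)) \<ge> 2"
  shows "verts (internal_core G) \<subseteq> \<Union>(edges (internal_core G))"
proof (rule ccontr)
  assume "\<not> ?thesis"
  then obtain v where v: "v \<in> verts (internal_core G)" "v \<notin> \<Union>(edges (internal_core G))" by auto
  have "{v} = verts (internal_core G)"
  proof (rule internal_core_closed_subset[OF assms(1,2)])
    fix x y assume "x \<in> {v}" "y \<in> verts (internal_core G)" "adjacent G x y"
    then have "{v, y} \<in> edges (internal_core G)"
      using v by (auto simp: internal_core_def induced_subgraph_def adjacent_def)
    then show "y \<in> {v}" using v(2) by auto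
  qed (use v in auto)
  then show False using assms(3) by (metis card_1_singleton_iff One_nat_def not_less_eq_eq numeral_2_eq_2 order_refl)
qed

section \<open>Weighted graphs with unique weights at the branching vertices\<close>

text \<open>The combinatorial core of the reconstruction. A vertex on two or more edges is
  recognised by its weight alone; any other vertex lies on at most one edge e and is recognised by
  its weight within \<open>\<psi> e\<close>, as long as the two ends of an edge have different
  weights. The exception, an edge with equal end weights, is confined by \<open>equal_ends\<close>
  to a graph that is a single edge.\<close>

lemma weight_preserving_isomorphism:
  fixes w :: "'a \<Rightarrow> nat" and w' :: "'b \<Rightarrow> nat"
  assumes fin: "finite C" "finite C'"
    and weights: "image_mset w (mset_set C) = image_mset w' (mset_set C')"
    and E: "\<And>e. e \<in> E \<Longrightarrow> e \<subseteq> C \<and> card e = 2"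
    and E': "\<And>e. e \<in> E' \<Longrightarrow> e \<subseteq> C' \<and> card e = 2"
    and \<psi>: "bij_betw \<psi> E E'"
    and edge_weights: "\<And>e. e \<in> E \<Longrightarrow> image_mset w (mset_set e) = image_mset w' (mset_set (\<psi> e))"
    and unique: "\<And>u v. u \<in> C \<Longrightarrow> v \<in> C \<Longrightarrow> card {e \<in> E. v \<in> e} \<ge> 2 \<Longrightarrow> w u = w v \<Longrightarrow> u = v"
    and cover: "card C' \<ge> 2 \<Longrightarrow> C' \<subseteq> \<Union>E'"
    and equal_ends: "\<And>e. e \<in> E \<Longrightarrow> \<not> inj_on w e \<Longrightarrow> e = C"
  shows "\<exists>f. bij_betw f C C' \<and> (\<forall>v\<in>C. w' (f v) = w v) \<and>
             (\<forall>u\<in>C. \<forall>v\<in>C. {u, v} \<in> E \<longleftrightarrow> {f u, f v} \<in> E')"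
proof (cases "\<exists>e\<in>E. \<not> inj_on w e")
  case True
  \<comment> \<open>Both graphs consist of one edge covering everything, so any weight-preserving
    bijection of the vertices is an isomorphism.\<close>
  then have C: "C \<in> E" using equal_ends by auto
  have cardC: "card C = card C'"
    using arg_cong[OF weights, of size] by simp
  have "E = {C}"
    using C E by (auto intro!: card_subset_eq[OF fin(1)])
  have "\<psi> C \<in> E'" using C \<psi> by (auto simp: bij_betw_def)
  moreover have "e = C'" if "e \<in> E'" for e
    using E'[OF that] E[OF C] cardC by (intro card_subset_eq[OF fin(2)]) auto
  ultimately have "E' = {C'}" by auto
  obtain f where f: "bij_betw f C C'" "\<forall>v\<in>C. w' (f v) = w v"
    using bij_betw_of_image_mset_eq[OF fin weights] by auto
  have "{u, v} = C \<longleftrightarrow> {f u, f v} = C'" if "u \<in> C" "v \<in> C" for u v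
  proof -
    have "{u, v} = C \<longleftrightarrow> f ` {u, v} = f ` C"
      using f(1) that by (intro inj_on_image_eq_iff[symmetric]) (auto simp: bij_betw_def)
    then show ?thesis using f(1) by (auto simp: bij_betw_def)
  qed
  then show ?thesis
    using f \<open>E = {C}\<close> \<open>E' = {C'}\<close> by auto
next
  case False
  have finE: "finite e" if "e \<in> E" for e using E[OF that] fin(1) by (auto intro: finite_subset)
  have \<psi>E: "\<psi> e \<in> E'" if "e \<in> E" for e using \<psi> that by (auto simp: bij_betw_def)
  have fin\<psi>: "finite (\<psi> e)" if "e \<in> E" for e
    using E'[OF \<psi>E[OF that]] fin(2) by (auto intro: finite_subset)
  have values_edge: "w ` e = w' ` \<psi> e" if "e \<in> E" for e
    using arg_cong[OF edge_weights[OF that], of set_mset] finE[OF that] fin\<psi>[OF that] by simp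
  have valuesC: "w ` C = w' ` C'"
    using arg_cong[OF weights, of set_mset] fin by simp
  have edge_value: "\<exists>x\<in>\<psi> e. w' x = w v" if "e \<in> E" "v \<in> e" for e v
  proof -
    have "w v \<in> w' ` \<psi> e"
      unfolding values_edge[OF that(1), symmetric] using that(2) by (rule imageI)
    then show ?thesis by auto
  qed
  have edge_value': "\<exists>x\<in>e. w x = w' v" if "e \<in> E" "v \<in> \<psi> e" for e v
  proof -
    have "w' v \<in> w ` e"
      unfolding values_edge[OF that(1)] using that(2) by (rule imageI)
    then show ?thesis by auto
  qed
  have vert_value: "\<exists>x\<in>C'. w' x = w v" if "v \<in> C" for v
  proof -
    have "w v \<in> w' ` C'"
      unfolding valuesC[symmetric] using that by (rule imageI)
    then show ?thesis by auto
  qed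
  have vert_value': "\<exists>x\<in>C. w x = w' v" if "v \<in> C'" for v
  proof -
    have "w' v \<in> w ` C"
      unfolding valuesC using that by (rule imageI)
    then show ?thesis by auto
  qed
  have cardC: "card C = card C'"
    using arg_cong[OF weights, of size] by simp
  \<comment> \<open>The weights on e are two distinct values, and those on \<open>\<psi> e\<close>
    are the same two values.\<close>
  have inj': "inj_on w' (\<psi> e)" if e: "e \<in> E" for e
  proof (rule eq_card_imp_inj_on[OF fin\<psi>[OF e]])
    have "card (w ` e) = card e" using False e by (intro card_image) auto
    then show "card (w' ` \<psi> e) = card (\<psi> e)"
      using values_edge[OF e] E[OF e] E'[OF \<psi>E[OF e]] by simp
  qed
  have fibers: "card {x \<in> C. w x = c} = card {x \<in> C'. w' x = c}" for c
    using arg_cong[OF weights, of "\<lambda>M. count M c"] fin by (simp add: count_image_mset_mset_set)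
  \<comment> \<open>Fibres of the two weight functions over the same value have equal size, so a
    weight that is unique in \<open>C\<close> is unique in \<open>C'\<close>.\<close>
  have unique': "x = y" if "v \<in> C" "\<And>u. u \<in> C \<Longrightarrow> w u = w v \<Longrightarrow> u = v"
    "x \<in> C'" "y \<in> C'" "w' x = w v" "w' y = w v" for v x y
  proof -
    have "{x \<in> C. w x = w v} = {v}" using that(1,2) by auto
    then have "card {x \<in> C'. w' x = w v} = 1" using fibers[of "w v"] by simp
    then obtain z where "{x \<in> C'. w' x = w v} = {z}" by (metis card_1_singletonE)
    moreover have "x \<in> {x \<in> C'. w' x = w v}" "y \<in> {x \<in> C'. w' x = w v}"
      using that(3-6) by auto
    ultimately show ?thesis by simp
  qed
  \<comment> \<open>The image of v has to lie on the images of all edges at v simultaneously. With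
    several edges the unique weight selects the same vertex on each; with one edge only that edge
    matters; with none any vertex of the right weight will do.\<close>
  have "\<exists>v'. v' \<in> C' \<and> w' v' = w v \<and> (\<forall>e\<in>E. v \<in> e \<longrightarrow> v' \<in> \<psi> e)" if v: "v \<in> C" for v
  proof (cases "card {e \<in> E. v \<in> e} \<ge> 2")
    case True
    obtain v' where v': "v' \<in> C'" "w' v' = w v" using vert_value[OF v] by auto
    have "v' \<in> \<psi> e" if e: "e \<in> E" "v \<in> e" for e
    proof -
      obtain x where x: "x \<in> \<psi> e" "w' x = w v" using edge_value[OF e] by auto
      then have "x \<in> C'" using E'[OF \<psi>E[OF e(1)]] by auto
      then have "x = v'"
        using unique'[OF v _ _ v'(1), of x] unique[OF _ v True] x v' by blast
      then show ?thesis using x by simp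
    qed
    then show ?thesis using v' by auto
  next
    case few: False
    show ?thesis
    proof (cases "\<exists>e\<in>E. v \<in> e")
      case True
      then obtain e where e: "e \<in> E" "v \<in> e" by auto
      have "finite E" using E fin(1) by (auto intro!: finite_subset[of E "Pow C"])
      then have "d = e" if "d \<in> E" "v \<in> d" for d
        using few e that card_mono[of "{e \<in> E. v \<in> e}" "{d, e}"] by (cases "d = e") auto
      moreover obtain x where "x \<in> \<psi> e" "w' x = w v"
        using edge_value[OF e] by auto
      ultimately show ?thesis using E'[OF \<psi>E[OF e(1)]] by blast
    next
      case False
      then show ?thesis using vert_value[OF v] by auto
    qed
  qed
  then obtain f where f: "\<And>v. v \<in> C \<Longrightarrow> f v \<in> C' \<and> w' (f v) = w v \<and> (\<forall>e\<in>E. v \<in> e \<longrightarrow> f v \<in> \<psi> e)"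
    by metis
  \<comment> \<open>Surjectivity suffices, as \<open>C\<close> and \<open>C'\<close> have the same
    order. If the weight of v' is not unique, then \<open>C'\<close> has at least two vertices, so
    v' lies on some \<open>\<psi> e\<close>, whose ends are told apart by their weights.\<close>
  have "C' \<subseteq> f ` C"
  proof
    fix v' assume v': "v' \<in> C'"
    then obtain v where v: "v \<in> C" "w v = w' v'" using vert_value'[OF v'] by auto
    show "v' \<in> f ` C"
    proof (cases "\<forall>u\<in>C. w u = w v \<longrightarrow> u = v")
      case True
      have fv: "f v \<in> C'" "w' (f v) = w v" using f[OF v(1)] by blast+
      have "f v = v'"
        by (rule unique'[OF v(1) _ fv(1) v' fv(2) v(2)[symmetric]]) (use True in blast)
      then show ?thesis using v by auto
    next
      case False
      then obtain u where "u \<in> C" "u \<noteq> v" by auto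
      then have "card {u, v} \<le> card C" using v(1) fin(1) by (intro card_mono) auto
      then have "card C' \<ge> 2" using cardC \<open>u \<noteq> v\<close> by simp
      then obtain e' where "e' \<in> E'" "v' \<in> e'" using cover v' by auto
      then obtain e where e: "e \<in> E" "v' \<in> \<psi> e" using \<psi> by (auto simp: bij_betw_def)
      then obtain x where x: "x \<in> e" "w x = w' v'" using edge_value'[OF e] by auto
      then have "x \<in> C" using E[OF e(1)] by auto
      then have "f x = v'"
      proof (intro inj_onD[OF inj'[OF e(1)]])
        show "w' (f x) = w' v'" using f[OF \<open>x \<in> C\<close>] x(2) by metis
        show "f x \<in> \<psi> e" using f[OF \<open>x \<in> C\<close>] x(1) e(1) by blast
      qed (rule e(2))
      then show ?thesis using \<open>x \<in> C\<close> by auto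
    qed
  qed
  then have img: "f ` C = C'" using f by blast
  then have "inj_on f C" using cardC by (intro eq_card_imp_inj_on[OF fin(1)]) simp
  then have bij: "bij_betw f C C'" using img by (simp add: bij_betw_def)
  have f_edge: "f ` e = \<psi> e" if e: "e \<in> E" for e
  proof (rule card_subset_eq[OF fin\<psi>[OF e]])
    show "f ` e \<subseteq> \<psi> e" using f E[OF e] e by blast
    have "card (f ` e) = card e"
      using \<open>inj_on f C\<close> E[OF e] by (intro card_image) (auto intro: inj_on_subset)
    then show "card (f ` e) = card (\<psi> e)" using E[OF e] E'[OF \<psi>E[OF e]] by simp
  qed
  have "{u, v} \<in> E \<longleftrightarrow> {f u, f v} \<in> E'" if uv: "u \<in> C" "v \<in> C" for u v
  proof
    assume "{u, v} \<in> E"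
    then show "{f u, f v} \<in> E'" using f_edge[of "{u, v}"] \<psi>E[of "{u, v}"] by simp
  next
    assume "{f u, f v} \<in> E'"
    then obtain e where e: "e \<in> E" "\<psi> e = {f u, f v}" using \<psi> by (auto simp: bij_betw_def)
    then have "f ` e = f ` {u, v}" using f_edge by simp
    then have "e = {u, v}"
      using inj_on_image_eq_iff[OF \<open>inj_on f C\<close>, of e "{u, v}"] E[OF e(1)] uv by simp
    then show "{u, v} \<in> E" using e by simp
  qed
  then show ?thesis using bij f by auto
qed

section \<open>Recovering the weighted core\<close>

text \<open>\<open>N\<close> is the type before a merger and \<open>M\<close> the type after it, so
  the two types determine the merged parts. Eliminating both types leaves an equation between the
  four parts; if the two sums differed, a + b would have to equal a or b, which positivity
  excludes.\<close>

lemma merged_pair_unique: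
  fixes a b a' b' :: nat
  assumes pos: "a > 0" "b > 0"
    and eq: "M + {#a, b#} = N + {#a + b#}" "M + {#a', b'#} = N + {#a' + b'#}"
  shows "{#a, b#} = {#a', b'#}"
proof -
  have "M + {#a, b#} + {#a' + b'#} = M + {#a', b'#} + {#a + b#}"
    unfolding eq by simp
  then have swap: "{#a, b#} + {#a' + b'#} = {#a', b'#} + {#a + b#}"
    by (simp only: add.assoc add_left_cancel)
  show ?thesis
  proof (cases "a + b = a' + b'")
    case True
    then show ?thesis using swap by simp
  next
    case False
    have "a + b \<in># {#a, b#} + {#a' + b'#}"
      unfolding swap by simp
    then show ?thesis using pos False by auto
  qed
qed

lemma leaf_weight_pos: "leaf_weight G v > 0"
  by (simp add: leaf_weight_def)

lemma core_edge_doubleton: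
  assumes "finite_simple_graph G" "e \<in> edges (internal_core G)"
  obtains u v where "e = {u, v}" "u \<noteq> v" "u \<in> verts (internal_core G)" "v \<in> verts (internal_core G)"
proof -
  have "e \<subseteq> verts (internal_core G)" "card e = 2"
    using finite_simple_graph_internal_core[OF assms(1)] assms(2)
    by (auto simp only: finite_simple_graph_def)
  from this(2) obtain u v where "e = {u, v}" "u \<noteq> v" by (auto simp: card_2_iff)
  then show thesis using that \<open>e \<subseteq> verts (internal_core G)\<close> by blast
qed

lemma component_type_insert_core_edge:
  assumes "tree G" "card (verts G) \<ge> 3" "e \<in> edges (internal_core G)"
  shows "component_type (verts G) (insert e (leaf_edges G)) + image_mset (leaf_weight G) (mset_set e) =
         component_type (verts G) (leaf_edges G) + {#\<Sum>v\<in>e. leaf_weight G v#}"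
proof -
  have G: "finite_simple_graph G" "connected_graph G" using assms(1) by (auto simp: tree_def)
  obtain u v where e: "e = {u, v}" "u \<noteq> v"
    and uv: "u \<in> verts (internal_core G)" "v \<in> verts (internal_core G)"
    by (rule core_edge_doubleton[OF G(1) assms(3)])
  have L: "leaf_edges G \<subseteq> edges G" by (auto simp: leaf_edges_def)
  have "{u, v} \<in> edges G" "{u, v} \<notin> leaf_edges G"
    using assms(3) e by (auto simp: edges_internal_core[OF G(1)])
  from component_type_insert_edge[OF assms(1) L this]
  show ?thesis
    using e by (simp add: card_component_leaf_edges[OF G assms(2) uv(1)]
        card_component_leaf_edges[OF G assms(2) uv(2)])
qed

lemma card_verts_eq:
  assumes "finite_simple_graph G" "finite_simple_graph H" "A \<subseteq> edges G" "B \<subseteq> edges H"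
    and "component_type (verts H) B = component_type (verts G) A"
  shows "card (verts H) = card (verts G)"
  using sum_mset_component_type[of "verts G" A] sum_mset_component_type[of "verts H" B]
    edges_subset_verts[OF assms(1,3)] edges_subset_verts[OF assms(2,4)] assms
  by (simp add: finite_simple_graph_def)

lemma chromatic_symmetric_function_determines_card_verts:
  assumes "tree T" "tree T'" "chromatic_symmetric_function T' = chromatic_symmetric_function T"
  shows "card (verts T') = card (verts T)"
proof -
  obtain \<phi> where \<phi>: "bij_betw \<phi> (Pow (edges T)) (Pow (edges T'))"
    "\<forall>A\<in>Pow (edges T). component_type (verts T') (\<phi> A) = component_type (verts T) A"
    using chromatic_symmetric_function_determines_types[OF assms] by auto
  \<comment> \<open>Any edge subset would serve, because the parts of every type add up to the
    number of vertices.\<close>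
  have "\<phi> {} \<subseteq> edges T'" using \<phi>(1) by (auto simp: bij_betw_def)
  then show ?thesis
    using card_verts_eq[of T T' "{}" "\<phi> {}"] \<phi>(2) assms by (auto simp: tree_def)
qed

text \<open>Every cover contains all leaf edges. So a cover with one edge more arises by adding one
  core edge, and the core edges become visible as covers.\<close>

lemma covers_of_next_size:
  assumes "finite_simple_graph G" "verts G \<subseteq> \<Union>(leaf_edges G)"
  shows "bij_betw (\<lambda>e. insert e (leaf_edges G)) (edges (internal_core G))
     {A \<in> Pow (edges G). card A = Suc (card (leaf_edges G)) \<and> verts G \<subseteq> \<Union>A}"
    (is "bij_betw ?h _ ?S")
proof -
  let ?L = "leaf_edges G"
  have L: "?L \<subseteq> edges G" by (auto simp: leaf_edges_def)
  have fE: "finite (edges G)" using assms(1) by (rule finite_edges)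
  have fL: "finite ?L" using L fE by (rule finite_subset)
  show ?thesis
    unfolding edges_internal_core[OF assms(1)] bij_betw_def
  proof (intro conjI set_eqI iffI)
    show "inj_on ?h (edges G - ?L)" by (auto simp: inj_on_def)
  next
    fix A assume "A \<in> ?h ` (edges G - ?L)"
    then obtain e where "e \<in> edges G" "e \<notin> ?L" "A = insert e ?L" by auto
    then show "A \<in> ?S" using fL L assms(2) by auto
  next
    fix A assume A: "A \<in> ?S"
    then have "?L \<subseteq> A" using leaf_edges_subset_cover[OF assms(1), of A] by auto
    then have "card (A - ?L) = 1" using A fL by (simp add: card_Diff_subset)
    then obtain e where "A - ?L = {e}" by (metis card_1_singletonE)
    then have "A = insert e ?L" "e \<in> edges G - ?L" using \<open>?L \<subseteq> A\<close> A by auto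
    then show "A \<in> ?h ` (edges G - ?L)" by blast
  qed
qed

text \<open>The type-preserving bijection \<open>\<phi>\<close> of edge subsets also preserves size
  and covering. It therefore matches the leaf edges of the two trees, which gives the weights, and
  the covers with one edge more, which gives the core edges. \<open>\<phi>\<close> need not respect
  inclusion, so all information comes from types and cover counts.\<close>

lemma chromatic_symmetric_function_determines_weights:
  fixes T :: "'a graph" and T' :: "'b graph"
  assumes T: "proper_tree T" and T': "tree T'"
    and X: "chromatic_symmetric_function T' = chromatic_symmetric_function T"
    and n: "card (verts T) \<ge> 3"
  shows "image_mset (leaf_weight T) (mset_set (verts (internal_core T))) =
         image_mset (leaf_weight T') (mset_set (verts (internal_core T')))"
    and "\<exists>\<psi>. bij_betw \<psi> (edges (internal_core T)) (edges (internal_core T')) \<and>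
           (\<forall>e\<in>edges (internal_core T). image_mset (leaf_weight T) (mset_set e) =
              image_mset (leaf_weight T') (mset_set (\<psi> e)))"
proof -
  let ?L = "leaf_edges T" and ?L' = "leaf_edges T'"
  let ?t = "component_type (verts T)" and ?t' = "component_type (verts T')"
  have tree: "tree T" using T by (simp add: proper_tree_def)
  have sg: "finite_simple_graph T" "connected_graph T" and sg': "finite_simple_graph T'" "connected_graph T'"
    using tree T' by (auto simp: tree_def)
  have n': "card (verts T') = card (verts T)"
    by (rule chromatic_symmetric_function_determines_card_verts[OF tree T' X])
  obtain \<phi> where bij: "bij_betw \<phi> (Pow (edges T)) (Pow (edges T'))"
    and type: "\<forall>A\<in>Pow (edges T). ?t' (\<phi> A) = ?t A"
    using chromatic_symmetric_function_determines_types[OF tree T' X] by auto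
  have fE: "finite (edges T)" "finite (edges T')" using sg(1) sg'(1) by (auto intro: finite_edges)
  have sub: "\<phi> A \<subseteq> edges T'" if "A \<in> Pow (edges T)" for A
    using bij that by (auto simp: bij_betw_def)
  \<comment> \<open>The number of edges is the number of vertices minus the number of parts, and
    both of these agree in the two trees.\<close>
  have card: "card (\<phi> A) = card A" if A: "A \<in> Pow (edges T)" for A
    using card_plus_size_component_type[OF tree, of A] card_plus_size_component_type[OF T' sub[OF A]]
      type A n' by auto
  have cover: "verts T' \<subseteq> \<Union>(\<phi> A) \<longleftrightarrow> verts T \<subseteq> \<Union>A" if A: "A \<in> Pow (edges T)" for A
  proof -
    have "1 \<in># ?t A \<longleftrightarrow> \<not> verts T \<subseteq> \<Union>A"
      using A sg(1) edges_subset_verts[OF sg(1), of A]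
      by (intro one_in_component_type_iff) (auto simp: finite_simple_graph_def)
    moreover have "1 \<in># ?t' (\<phi> A) \<longleftrightarrow> \<not> verts T' \<subseteq> \<Union>(\<phi> A)"
      using sub[OF A] sg'(1) edges_subset_verts[OF sg'(1), of "\<phi> A"]
      by (intro one_in_component_type_iff) (auto simp: finite_simple_graph_def)
    moreover have "?t' (\<phi> A) = ?t A" using type A by blast
    ultimately show ?thesis by simp
  qed
  have cardE: "card (edges T') = card (edges T)"
  proof (rule antisym)
    show "card (edges T) \<le> card (edges T')"
      using card[of "edges T"] card_mono[OF fE(2) sub[of "edges T"]] by simp
    have "edges T' \<in> \<phi> ` Pow (edges T)" using bij by (auto simp: bij_betw_def)
    then obtain A where "A \<in> Pow (edges T)" "edges T' = \<phi> A" by auto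
    then show "card (edges T') \<le> card (edges T)"
      using card[of A] card_mono[OF fE(1), of A] by simp
  qed
  have "card {A \<in> Pow (edges T). Suc (card A) = card (edges T) \<and> verts T \<subseteq> \<Union>A} =
      card {A \<in> Pow (edges T'). Suc (card A) = card (edges T') \<and> verts T' \<subseteq> \<Union>A}"
    by (rule bij_betw_same_card[OF bij_betw_Collect[OF bij]]) (simp add: card cover cardE)
  then have "card (edges T - ?L) = card (edges T' - ?L')"
    using card_covers_missing_one_edge[OF sg] card_covers_missing_one_edge[OF sg'] n n' by simp
  moreover have LE: "?L \<subseteq> edges T" "?L' \<subseteq> edges T'" by (auto simp: leaf_edges_def)
  ultimately have cardL: "card ?L' = card ?L"
    using cardE card_mono[OF fE(1) LE(1)] card_mono[OF fE(2) LE(2)]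
    by (simp add: card_Diff_subset[OF finite_subset[OF LE(1) fE(1)]]
        card_Diff_subset[OF finite_subset[OF LE(2) fE(2)]])
  have coverT: "verts T \<subseteq> \<Union>?L"
    using proper_tree_leaf_edges_cover[OF T] n by simp
  \<comment> \<open>The image of the leaf edges of \<open>T\<close> is a cover of \<open>T'\<close>,
    hence contains the leaf edges of \<open>T'\<close>; equal numbers force equality. In particular
    the leaf edges of \<open>T'\<close> form a cover as well.\<close>
  have L\<phi>: "?L' = \<phi> ?L"
  proof (rule card_subset_eq)
    show "finite (\<phi> ?L)" using sub[of ?L] LE(1) fE(2) by (auto intro: finite_subset)
    show "?L' \<subseteq> \<phi> ?L"
      using cover[of ?L] coverT LE(1) sub[of ?L] by (intro leaf_edges_subset_cover[OF sg'(1)]) auto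
    show "card ?L' = card (\<phi> ?L)" using card[of ?L] LE(1) cardL by simp
  qed
  then have tL: "?t' ?L' = ?t ?L" using type LE(1) by auto
  then show "image_mset (leaf_weight T) (mset_set (verts (internal_core T))) =
         image_mset (leaf_weight T') (mset_set (verts (internal_core T')))"
    using component_type_leaf_edges[OF sg n] component_type_leaf_edges[OF sg'] n n' by simp
  have coverT': "verts T' \<subseteq> \<Union>?L'" using cover[of ?L] coverT LE(1) L\<phi> by simp
  let ?S = "{A \<in> Pow (edges T). card A = Suc (card ?L) \<and> verts T \<subseteq> \<Union>A}"
    and ?S' = "{A \<in> Pow (edges T'). card A = Suc (card ?L') \<and> verts T' \<subseteq> \<Union>A}"
  let ?h = "\<lambda>e. insert e ?L" and ?h' = "\<lambda>e. insert e ?L'"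
  let ?E = "edges (internal_core T)" and ?E' = "edges (internal_core T')"
  have h: "bij_betw ?h ?E ?S" and h': "bij_betw ?h' ?E' ?S'"
    using covers_of_next_size sg(1) sg'(1) coverT coverT' by blast+
  have "bij_betw \<phi> ?S ?S'"
    by (rule bij_betw_Collect[OF bij]) (simp add: card cover cardL)
  \<comment> \<open>The partner of a core edge e: add e to the leaf edges of \<open>T\<close>, apply
    \<open>\<phi>\<close>, and take the edge by which the resulting cover exceeds the leaf edges of
    \<open>T'\<close>.\<close>
  then have \<psi>: "bij_betw (the_inv_into ?E' ?h' \<circ> (\<phi> \<circ> ?h)) ?E ?E'"
    using bij_betw_trans[OF bij_betw_trans[OF h] bij_betw_the_inv_into[OF h']] by simp
  let ?\<psi> = "the_inv_into ?E' ?h' \<circ> (\<phi> \<circ> ?h)"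
  have "image_mset (leaf_weight T) (mset_set e) = image_mset (leaf_weight T') (mset_set (?\<psi> e))"
    if e: "e \<in> ?E" for e
  proof -
    have \<psi>e: "?\<psi> e \<in> ?E'" by (rule bij_betw_apply[OF \<psi> e])
    have he: "?h e \<in> ?S" by (rule bij_betw_apply[OF h e])
    then have "\<phi> (?h e) \<in> ?S'" by (rule bij_betw_apply[OF \<open>bij_betw \<phi> ?S ?S'\<close>])
    then have "?h' (?\<psi> e) = \<phi> (?h e)"
      using f_the_inv_into_f_bij_betw[OF h'] by simp
    then have type_e: "?t' (?h' (?\<psi> e)) = ?t (?h e)" using type he by auto
    obtain u v where uv: "e = {u, v}" "u \<noteq> v"
      by (rule core_edge_doubleton[OF sg(1) e])
    obtain x y where xy: "?\<psi> e = {x, y}" "x \<noteq> y"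
      by (rule core_edge_doubleton[OF sg'(1) \<psi>e])
    have "?t (?h e) + {#leaf_weight T u, leaf_weight T v#} =
        ?t ?L + {#leaf_weight T u + leaf_weight T v#}"
      using component_type_insert_core_edge[OF tree n e] uv by simp
    moreover have "?t (?h e) + {#leaf_weight T' x, leaf_weight T' y#} =
        ?t ?L + {#leaf_weight T' x + leaf_weight T' y#}"
      using component_type_insert_core_edge[OF T' _ \<psi>e] n n' unfolding type_e tL unfolding xy(1)
      using xy(2) by simp
    ultimately have "{#leaf_weight T u, leaf_weight T v#} = {#leaf_weight T' x, leaf_weight T' y#}"
      by (rule merged_pair_unique[OF leaf_weight_pos leaf_weight_pos])
    then show ?thesis unfolding xy(1) unfolding uv(1) using xy(2) uv(2) by simp
  qed
  then show "\<exists>\<psi>. bij_betw \<psi> ?E ?E' \<and> (\<forall>e\<in>?E. image_mset (leaf_weight T) (mset_set e) =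
              image_mset (leaf_weight T') (mset_set (\<psi> e)))"
    using \<psi> by blast
qed

section \<open>Extending an isomorphism of weighted cores to the leaves\<close>

text \<open>Equal weights mean equally many leaves at v and at f v. Bijections between these leaf
  sets can be chosen independently at each core vertex, since a leaf has no other neighbour.\<close>

lemma graph_isomorphic_of_core_isomorphism:
  assumes G: "finite_simple_graph G" "connected_graph G" "card (verts G) \<ge> 3"
    and H: "finite_simple_graph H" "connected_graph H" "card (verts H) \<ge> 3"
    and f: "bij_betw f (verts (internal_core G)) (verts (internal_core H))"
    and weight: "\<And>v. v \<in> verts (internal_core G) \<Longrightarrow> leaf_weight H (f v) = leaf_weight G v"
    and adj: "\<And>u v. u \<in> verts (internal_core G) \<Longrightarrow> v \<in> verts (internal_core G) \<Longrightarrow>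
                {u, v} \<in> edges (internal_core G) \<longleftrightarrow> {f u, f v} \<in> edges (internal_core H)"
  shows "graph_isomorphic G H"
proof -
  let ?C = "verts (internal_core G)" and ?D = "verts (internal_core H)"
  define lv where "lv v = {u \<in> verts G. is_leaf G u \<and> adjacent G u v}" for v
  define lv' where "lv' v = {u \<in> verts H. is_leaf H u \<and> adjacent H u v}" for v
  \<comment> \<open>Meaningful for leaves only, whose neighbour is unique; it is applied to no other
    vertices below.\<close>
  define nb where "nb u = (THE v. adjacent G v u)" for u
  define nb' where "nb' u = (THE v. adjacent H v u)" for u
  have nb: "adjacent G v u \<longleftrightarrow> v = nb u" if "is_leaf G u" for u v
    using theI'[OF leaf_unique_neighbour[OF G(1) that]] leaf_unique_neighbour[OF G(1) that]
    unfolding nb_def by blast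
  have nb': "adjacent H v u \<longleftrightarrow> v = nb' u" if "is_leaf H u" for u v
    using theI'[OF leaf_unique_neighbour[OF H(1) that]] leaf_unique_neighbour[OF H(1) that]
    unfolding nb'_def by blast
  have nbC: "nb u \<in> ?C" if "is_leaf G u" for u
  proof -
    have "adjacent G u (nb u)" using nb[OF that, of "nb u"] adjacent_sym by metis
    then show ?thesis
      using leaf_neighbour_not_leaf[OF G that] adjacentD(2)[OF G(1)] by auto
  qed
  have nbD: "nb' u \<in> ?D" if "is_leaf H u" for u
  proof -
    have "adjacent H u (nb' u)" using nb'[OF that, of "nb' u"] adjacent_sym by metis
    then show ?thesis
      using leaf_neighbour_not_leaf[OF H that] adjacentD(2)[OF H(1)] by auto
  qed
  have lv_iff: "u \<in> lv v \<longleftrightarrow> is_leaf G u \<and> v = nb u" for u v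
    using nb[of u v] adjacent_sym[of G u v] by (auto simp: lv_def is_leaf_def)
  have lv'_iff: "u \<in> lv' v \<longleftrightarrow> is_leaf H u \<and> v = nb' u" for u v
    using nb'[of u v] adjacent_sym[of H u v] by (auto simp: lv'_def is_leaf_def)
  have fin: "finite (lv v)" "finite (lv' v')" for v v'
    using G(1) H(1) by (auto simp: lv_def lv'_def finite_simple_graph_def)
  have "\<exists>g. bij_betw g (lv v) (lv' (f v))" if "v \<in> ?C" for v
    using weight[OF that] fin by (intro finite_same_card_bij) (simp_all add: leaf_weight_def lv_def lv'_def)
  then obtain g where g: "\<And>v. v \<in> ?C \<Longrightarrow> bij_betw (g v) (lv v) (lv' (f v))" by metis
  define F where "F x = (if x \<in> ?C then f x else g (nb x) x)" for x
  have leafF: "is_leaf H (F x)" "nb' (F x) = f (nb x)" "F x = g (nb x) x" if "is_leaf G x" for x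
  proof -
    show Fx: "F x = g (nb x) x" using that by (simp add: F_def)
    have "x \<in> lv (nb x)" using that by (simp add: lv_iff)
    then have "F x \<in> lv' (f (nb x))"
      using g[OF nbC[OF that]] unfolding Fx by (auto simp only: bij_betw_def)
    then show "is_leaf H (F x)" "nb' (F x) = f (nb x)" by (auto simp: lv'_iff)
  qed
  have coreF: "F x = f x" "F x \<in> ?D" if "x \<in> ?C" for x
    using that f by (auto simp only: F_def bij_betw_def if_True)
  have cases: "x \<in> ?C \<or> is_leaf G x" if "x \<in> verts G" for x
    using that by auto
  have leaf_iff: "is_leaf H (F x) \<longleftrightarrow> is_leaf G x" if "x \<in> verts G" for x
    using cases[OF that] leafF(1)[of x] coreF(2)[of x] by auto
  have inj_f: "u = v" if "u \<in> ?C" "v \<in> ?C" "f u = f v" for u v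
    using f that by (metis bij_betw_def inj_onD)
  have "inj_on F (verts G)"
  proof (rule inj_onI)
    fix x y assume xy: "x \<in> verts G" "y \<in> verts G" "F x = F y"
    show "x = y"
    proof (cases "is_leaf G x")
      case True
      then have y: "is_leaf G y" using leaf_iff xy by metis
      have "f (nb x) = f (nb y)" using leafF(2)[OF True] leafF(2)[OF y] xy(3) by simp
      then have nbxy: "nb x = nb y" by (rule inj_f[OF nbC[OF True] nbC[OF y]])
      have "x \<in> lv (nb x)" "y \<in> lv (nb x)" using True y nbxy by (auto simp: lv_iff)
      moreover have "g (nb x) x = g (nb x) y"
        using leafF(3)[OF True] leafF(3)[OF y] xy(3) nbxy by simp
      ultimately show ?thesis
        using g[OF nbC[OF True]] by (metis bij_betw_def inj_onD)
    next
      case False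
      then have "x \<in> ?C" "y \<in> ?C" using xy leaf_iff by (metis cases)+
      then show ?thesis using coreF(1) xy(3) inj_f by metis
    qed
  qed
  moreover have "F ` verts G = verts H"
  proof (intro set_eqI iffI)
    fix y assume "y \<in> F ` verts G"
    then obtain x where x: "x \<in> verts G" "y = F x" by auto
    then show "y \<in> verts H"
      using cases[OF x(1)] leafF(1)[of x] coreF(2)[of x] by (auto simp: is_leaf_def)
  next
    fix y assume y: "y \<in> verts H"
    show "y \<in> F ` verts G"
    proof (cases "is_leaf H y")
      case True
      have "nb' y \<in> f ` ?C" using nbD[OF True] f by (simp only: bij_betw_def)
      then obtain v where v: "v \<in> ?C" "nb' y = f v" by auto
      then have "y \<in> lv' (f v)" using True by (simp add: lv'_iff)
      then have "y \<in> g v ` lv v" using g[OF v(1)] by (simp only: bij_betw_def)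
      then obtain x where x: "x \<in> lv v" "y = g v x" by auto
      then have "is_leaf G x" "v = nb x" by (auto simp: lv_iff)
      then have "F x = y" using leafF(3)[of x] x by simp
      then show ?thesis using \<open>is_leaf G x\<close> by (auto simp: is_leaf_def)
    next
      case False
      then have "y \<in> ?D" using y by simp
      then have "y \<in> f ` ?C" using f by (simp only: bij_betw_def)
      then obtain x where x: "x \<in> ?C" "y = f x" by auto
      then have "F x = y" "x \<in> verts G" using coreF(1)[of x] by auto
      then show ?thesis by blast
    qed
  qed
  ultimately have bij: "bij_betw F (verts G) (verts H)" by (simp add: bij_betw_def)
  \<comment> \<open>Adjacency to a leaf means being its one neighbour, and \<open>F\<close> carries
    the neighbour of a leaf to the neighbour of its image.\<close>
  have leaf_case: "adjacent G u v \<longleftrightarrow> adjacent H (F u) (F v)"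
    if u: "u \<in> verts G" and v: "is_leaf G v" for u v
  proof -
    have "adjacent G u v \<longleftrightarrow> u = nb v" by (rule nb[OF v])
    also have "\<dots> \<longleftrightarrow> F u = f (nb v)"
    proof
      assume eq: "F u = f (nb v)"
      then have "F u = F (nb v)" using coreF(1)[OF nbC[OF v]] by simp
      then show "u = nb v"
        using \<open>inj_on F (verts G)\<close> u nbC[OF v] by (auto dest: inj_onD)
    qed (use coreF(1)[OF nbC[OF v]] in simp)
    also have "\<dots> \<longleftrightarrow> adjacent H (F u) (F v)"
      using nb'[OF leafF(1)[OF v]] leafF(2)[OF v] by simp
    finally show ?thesis .
  qed
  have "adjacent G u v \<longleftrightarrow> adjacent H (F u) (F v)" if u: "u \<in> verts G" and v: "v \<in> verts G" for u v
  proof (cases "is_leaf G u \<or> is_leaf G v")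
    case True
    then show ?thesis
      using leaf_case[of u v] leaf_case[of v u] u v adjacent_sym[of G u v] adjacent_sym[of H "F u" "F v"]
      by blast
  next
    case False
    then have uv: "u \<in> ?C" "v \<in> ?C" using u v by auto
    have "f u \<in> ?D" "f v \<in> ?D" using coreF uv by metis+
    then show ?thesis
      using adj[OF uv] uv unfolding coreF(1)[OF uv(1)] coreF(1)[OF uv(2)]
      by (simp add: internal_core_def induced_subgraph_def adjacent_def)
  qed
  then show ?thesis using bij by (auto simp: graph_isomorphic_def)
qed

lemma graph_isomorphic_sym:
  assumes "graph_isomorphic G H"
  shows "graph_isomorphic H G"
proof -
  obtain f where f: "bij_betw f (verts G) (verts H)"
    and adj: "\<forall>u\<in>verts G. \<forall>v\<in>verts G. adjacent G u v \<longleftrightarrow> adjacent H (f u) (f v)"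
    using assms by (auto simp: graph_isomorphic_def)
  let ?g = "the_inv_into (verts G) f"
  have g: "bij_betw ?g (verts H) (verts G)"
    using f by (rule bij_betw_the_inv_into)
  have "adjacent H u v \<longleftrightarrow> adjacent G (?g u) (?g v)" if "u \<in> verts H" "v \<in> verts H" for u v
  proof -
    have "?g u \<in> verts G" "?g v \<in> verts G"
      using g that by (auto simp: bij_betw_def)
    then have "adjacent G (?g u) (?g v) \<longleftrightarrow> adjacent H (f (?g u)) (f (?g v))"
      using adj by blast
    then show ?thesis
      using f_the_inv_into_f_bij_betw[OF f] that by simp
  qed
  then show ?thesis using g by (auto simp: graph_isomorphic_def)
qed

text \<open>By uniqueness two ends of equal weight have core degree at most one. The edge is then
  closed under adjacency in the core and, by connectedness, is all of it.\<close>

lemma equal_weight_core_edge: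
  assumes G: "finite_simple_graph G" "connected_graph G"
    and unique: "\<And>u v. u \<in> verts (internal_core G) \<Longrightarrow> v \<in> verts (internal_core G) \<Longrightarrow>
      degree (internal_core G) v \<ge> 2 \<Longrightarrow> w u = w v \<Longrightarrow> u = v"
    and e: "e \<in> edges (internal_core G)" "\<not> inj_on w e"
  shows "e = verts (internal_core G)"
proof -
  let ?C = "internal_core G"
  have C: "finite_simple_graph ?C" by (rule finite_simple_graph_internal_core[OF G(1)])
  obtain a b where ab: "e = {a, b}" "a \<noteq> b" "a \<in> verts ?C" "b \<in> verts ?C"
    by (rule core_edge_doubleton[OF G(1) e(1)])
  have "w a = w b" using e(2) ab by (auto simp: inj_on_def)
  then have "\<not> degree ?C a \<ge> 2" "\<not> degree ?C b \<ge> 2"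
    using unique[OF ab(4,3)] unique[OF ab(3,4)] ab(2) by auto
  then have few: "card {d \<in> edges ?C. x \<in> d} \<le> 1" if "x \<in> e" for x
    using that ab(1) by (auto simp: degree_eq_card_edges[OF C])
  show ?thesis
  proof (rule internal_core_closed_subset[OF G])
    show "e \<subseteq> verts ?C" "e \<noteq> {}" using ab by auto
    fix x y assume x: "x \<in> e" and y: "y \<in> verts ?C" "adjacent G x y"
    have "{x, y} \<in> edges ?C"
      using x y ab by (auto simp: internal_core_def induced_subgraph_def adjacent_def)
    then have "{{x, y}, e} \<subseteq> {d \<in> edges ?C. x \<in> d}" using x e(1) by auto
    then have "card {{x, y}, e} \<le> 1"
      using few[OF x] card_mono[of "{d \<in> edges ?C. x \<in> d}" "{{x, y}, e}"] finite_edges[OF C] by auto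
    then have "{x, y} = e" by (cases "{x, y} = e") auto
    then show "y \<in> e" by auto
  qed
qed

theorem theorem1p1:
  fixes T :: "'a graph" and T' :: "'b graph"
  assumes "proper_tree T"
    and "\<forall>v \<in> verts (internal_core T). degree (internal_core T) v \<ge> 2 \<longrightarrow>
           \<not> (\<exists>u \<in> verts (internal_core T). u \<noteq> v \<and> leaf_weight T u = leaf_weight T v)"
    and "tree T'"
    and "chromatic_symmetric_function T' = chromatic_symmetric_function T"
  shows "graph_isomorphic T' T"
proof (cases "card (verts T) \<ge> 3")
  case False
  have tree: "tree T" using assms(1) by (simp add: proper_tree_def)
  have n: "card (verts T') = card (verts T)"
    by (rule chromatic_symmetric_function_determines_card_verts[OF tree assms(3,4)])
  have "finite (verts T)" "finite (verts T')"
    using tree assms(3) by (auto simp: tree_def finite_simple_graph_def)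
  \<comment> \<open>Trees of the same order at most two are complete, so an arbitrary bijection is
    an isomorphism.\<close>
  then obtain f where f: "bij_betw f (verts T') (verts T)"
    using finite_same_card_bij n by metis
  have "adjacent T' u v \<longleftrightarrow> adjacent T (f u) (f v)" if uv: "u \<in> verts T'" "v \<in> verts T'" for u v
  proof -
    have "f u \<in> verts T" "f v \<in> verts T" "f u = f v \<longleftrightarrow> u = v"
      using f uv by (auto simp: bij_betw_def inj_on_def)
    then show ?thesis
      using small_tree_adjacent_iff[OF assms(3) _ uv] small_tree_adjacent_iff[OF tree, of "f u" "f v"]
        False n by simp
  qed
  then show ?thesis using f by (auto simp: graph_isomorphic_def)
next
  case n: True
  let ?C = "internal_core T" and ?D = "internal_core T'"
  have tree: "tree T" using assms(1) by (simp add: proper_tree_def)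
  have n': "card (verts T') \<ge> 3"
    using chromatic_symmetric_function_determines_card_verts[OF tree assms(3,4)] n by simp
  have G: "finite_simple_graph T" "connected_graph T" using tree by (auto simp: tree_def)
  have H: "finite_simple_graph T'" "connected_graph T'" using assms(3) by (auto simp: tree_def)
  have C: "finite_simple_graph ?C" and D: "finite_simple_graph ?D"
    using G H finite_simple_graph_internal_core by blast+
  note weights = chromatic_symmetric_function_determines_weights[OF assms(1,3,4) n]
  obtain \<psi> where \<psi>: "bij_betw \<psi> (edges ?C) (edges ?D)"
    "\<forall>e\<in>edges ?C. image_mset (leaf_weight T) (mset_set e) = image_mset (leaf_weight T') (mset_set (\<psi> e))"
    using weights(2) by blast
  have unique: "u = v" if "u \<in> verts ?C" "v \<in> verts ?C" "degree ?C v \<ge> 2"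
    "leaf_weight T u = leaf_weight T v" for u v
    using assms(2) that by blast
  obtain f where "bij_betw f (verts ?C) (verts ?D)"
    "\<forall>v\<in>verts ?C. leaf_weight T' (f v) = leaf_weight T v"
    "\<forall>u\<in>verts ?C. \<forall>v\<in>verts ?C. {u, v} \<in> edges ?C \<longleftrightarrow> {f u, f v} \<in> edges ?D"
  proof (rule exE[OF weight_preserving_isomorphism[OF _ _ weights(1) _ _ \<psi>(1)]])
    show "finite (verts ?C)" "finite (verts ?D)"
      using C D by (auto simp only: finite_simple_graph_def)
    show "e \<subseteq> verts ?C \<and> card e = 2" if "e \<in> edges ?C" for e
      using C that by (auto simp only: finite_simple_graph_def)
    show "e \<subseteq> verts ?D \<and> card e = 2" if "e \<in> edges ?D" for e
      using D that by (auto simp only: finite_simple_graph_def)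
    show "image_mset (leaf_weight T) (mset_set e) = image_mset (leaf_weight T') (mset_set (\<psi> e))"
      if "e \<in> edges ?C" for e
      using \<psi>(2) that by blast
    show "u = v" if "u \<in> verts ?C" "v \<in> verts ?C" "card {e \<in> edges ?C. v \<in> e} \<ge> 2"
      "leaf_weight T u = leaf_weight T v" for u v
      using unique that by (simp only: degree_eq_card_edges[OF C])
    show "verts ?D \<subseteq> \<Union>(edges ?D)" if "card (verts ?D) \<ge> 2"
      by (rule internal_core_incident_edge[OF H that])
    show "e = verts ?C" if "e \<in> edges ?C" "\<not> inj_on (leaf_weight T) e" for e
      by (rule equal_weight_core_edge[OF G unique that])
  qed (use that in blast)
  then have "graph_isomorphic T T'"
    by (intro graph_isomorphic_of_core_isomorphism[OF G n H n']) blast+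
  then show ?thesis by (rule graph_isomorphic_sym)
qed

end
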